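(* Let $n_0$ be a positive integer. Then $\mathcal{F}_{n_0}(s)=\sum_{n\ge n_0}n^{-s}f(n)$ converges absolutely and uniformly on compact subsets of $\operatorname{Re}s>\log_q\rho+1$, hence is analytic there, and for $\operatorname{Re}s>\log_q\rho+1$ $$(I-q^{-s}C)\mathcal{F}_{n_0}(s)=\mathcal{G}_{n_0}(s),\qquad \mathcal{G}_{n_0}(s)=\sum_{n=n_0}^{qn_0-1}n^{-s}f(n)+q^{-s}\sum_{r=0}^{q-1}A_r\sum_{k\ge1}\binom{-s}{k}\Big(\frac rq\Big)^k\mathcal{F}_{n_0}(s+k).$$ The series in $\mathcal{G}_{n_0}$ converge absolutely and uniformly on compact sets for $\operatorname{Re}s>\log_q\rho$, so this identity gives a meromorphic continuation of $\mathcal{F}_{n_0}$ to $\operatorname{Re}s>\log_q\rho$ with possible poles only at $s=\log_q\lambda+\frac{2\pi i\ell}{\log q}$ for $\lambda\in\sigma(C)$ with $|\lambda|>\rho$ and $\ell\in\mathbb{Z}$, each of order at most $m(\lambda)$. Furthermore, let $\delta>0$ and $\mu_\delta(z)=\max\{1-(z-\log_q\rho-\delta),0\}$ for real $z$. Then $\mathcal{F}_{n_0}(s)=O(|\operatorname{Im}s|^{\mu_\delta(\operatorname{Re}s)})$ uniformly for $\operatorname{Re}s\ge\log_q\rho+\delta$ and $|q^s-\lambda|\ge\delta$ for all $\lambda\in\sigma(C)$, where the $O$-constant may also depend on $\delta$.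
   Context: Let $q\ge2$, $d\ge1$ be integers and $A_0,\dots,A_{q-1}\in\mathbb{C}^{d\times d}$. Define $f(0)=I$ and, for $n\ge1$ with $q$-ary expansion $r_{\ell-1}\dots r_0$ ($r_{\ell-1}\ne0$), $f(n)=A_{r_0}\cdots A_{r_{\ell-1}}$. $C=\sum_rA_r$, $\sigma(C)$ its spectrum, $m(\lambda)$ the size of the largest Jordan block of $C$ associated with $\lambda$. $\rho=\inf_\ell\sup\{\|A_{r_1}\cdots A_{r_\ell}\|^{1/\ell}: r_i\in\{0,\dots,q-1\}\}$ is the joint spectral radius (for any fixed submultiplicative matrix norm). $\log_q$ uses the principal logarithm. Implicit constants depend on $q,d,A_0,\dots,A_{q-1}$. *)

theory Defs
  imports "HOL-Complex_Analysis.Complex_Analysis"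
          "Jordan_Normal_Form.Jordan_Normal_Form"
          "Jordan_Normal_Form.Spectral_Radius"
begin

function qdigits :: "nat \<Rightarrow> nat \<Rightarrow> nat list" where
  "qdigits q n = (if q < 2 \<or> n = 0 then [] else n mod q # qdigits q (n div q))"
  by auto
termination
  by (relation "Wellfounded.measure (\<lambda>(q, n). n)") auto

definition mprod :: "nat \<Rightarrow> (nat \<Rightarrow> complex mat) \<Rightarrow> nat list \<Rightarrow> complex mat" where
  "mprod d A rs = foldr (\<lambda>r M. A r * M) rs (1\<^sub>m d)"

definition regf :: "nat \<Rightarrow> nat \<Rightarrow> (nat \<Rightarrow> complex mat) \<Rightarrow> nat \<Rightarrow> complex mat" where
  "regf q d A n = mprod d A (qdigits q n)"

definition fnorm :: "complex mat \<Rightarrow> real" where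
  "fnorm M = sqrt (\<Sum>i<dim_row M. \<Sum>j<dim_col M. (cmod (M $$ (i, j)))\<^sup>2)"

definition jsr :: "nat \<Rightarrow> nat \<Rightarrow> (nat \<Rightarrow> complex mat) \<Rightarrow> real" where
  "jsr q d A = (INF l \<in> {1::nat..}. SUP rs \<in> {rs. length rs = l \<and> set rs \<subseteq> {..<q}}.
                   fnorm (mprod d A rs) powr (1 / real l))"

definition sumA :: "nat \<Rightarrow> nat \<Rightarrow> (nat \<Rightarrow> complex mat) \<Rightarrow> complex mat" where
  "sumA q d A = mat d d (\<lambda>(i, j). \<Sum>r<q. A r $$ (i, j))"

definition dterm :: "nat \<Rightarrow> nat \<Rightarrow> (nat \<Rightarrow> complex mat) \<Rightarrow> nat \<Rightarrow> nat \<Rightarrow> nat \<Rightarrow> nat \<Rightarrow> complex \<Rightarrow> complex" where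
  "dterm q d A n0 i j k s = (of_nat (k + n0) :: complex) powr (- s) * (regf q d A (k + n0) $$ (i, j))"

definition dirF :: "nat \<Rightarrow> nat \<Rightarrow> (nat \<Rightarrow> complex mat) \<Rightarrow> nat \<Rightarrow> complex \<Rightarrow> complex mat" where
  "dirF q d A n0 s = mat d d (\<lambda>(i, j). \<Sum>k. dterm q d A n0 i j k s)"

definition bterm :: "nat \<Rightarrow> nat \<Rightarrow> (nat \<Rightarrow> complex mat) \<Rightarrow> nat \<Rightarrow> nat \<Rightarrow> nat \<Rightarrow> nat \<Rightarrow> nat \<Rightarrow> complex \<Rightarrow> complex" where
  "bterm q d A n0 r i j k s =
     ((- s) gchoose (Suc k)) * (of_nat r / of_nat q) ^ (Suc k) * (dirF q d A n0 (s + of_nat (Suc k)) $$ (i, j))"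

definition binser :: "nat \<Rightarrow> nat \<Rightarrow> (nat \<Rightarrow> complex mat) \<Rightarrow> nat \<Rightarrow> nat \<Rightarrow> complex \<Rightarrow> complex mat" where
  "binser q d A n0 r s = mat d d (\<lambda>(i, j). \<Sum>k. bterm q d A n0 r i j k s)"

definition dirG :: "nat \<Rightarrow> nat \<Rightarrow> (nat \<Rightarrow> complex mat) \<Rightarrow> nat \<Rightarrow> complex \<Rightarrow> complex mat" where
  "dirG q d A n0 s = mat d d (\<lambda>(i, j).
      (\<Sum>n\<in>{n0..<q * n0}. (of_nat n :: complex) powr (- s) * (regf q d A n $$ (i, j)))
      + (of_nat q :: complex) powr (- s) * (\<Sum>r<q. (A r * binser q d A n0 r s) $$ (i, j)))"

definition jordan_index :: "complex mat \<Rightarrow> complex \<Rightarrow> nat" where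
  "jordan_index C lam = Max {k. \<exists>n_as. jordan_nf C n_as \<and> (k, lam) \<in> set n_as}"

text \<open>mu_delta(z) = max{1 - (z - log_q rho - delta), 0}; for rho = 0 (log_q rho = -infinity) it is 0.\<close>
definition mu :: "nat \<Rightarrow> real \<Rightarrow> real \<Rightarrow> real \<Rightarrow> real" where
  "mu q rho \<delta> z = (if rho = 0 then 0 else max (1 - (z - log (real q) rho - \<delta>)) 0)"

end

theory Submission
  imports Defs
begin

text \<open>Submultiplicativity gives \<open>f(n) = O(n^t)\<close> whenever \<open>q^t\<close> exceeds the joint spectral
  radius, hence convergence of the Dirichlet series. Splitting the summation index as
  \<open>q n + r\<close> and expanding \<open>(q n + r)^{-s}\<close> binomially yields the functional equation. The
  resolvent \<open>(x I - C)^{-1}\<close> is an entire matrix function divided by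
  \<open>\<Prod> (x - \<lambda>)^{m(\<lambda>)}\<close>; substituting \<open>x = q^s\<close>, where \<open>q^s - \<lambda>\<close> has simple zeros only,
  gives the continuation and the pole orders. For the growth estimate, the inner binomial
  series is resummed to \<open>\<Sum> n^{-s} ((1 + r/(q n))^{-s} - 1) f(n)\<close>, and the increment is
  \<open>O((|s|/n)^\<theta>)\<close> for every \<open>\<theta>\<close> in \<open>[0, 1]\<close>; taking \<open>\<theta> = \<mu>\<^sub>\<delta>(Re s)\<close> moves the series just
  inside its half-plane of absolute convergence, so no convexity argument is needed.\<close>

text \<open>Half-planes are written as \<open>\<rho> < real q powr (Re s - a)\<close> because \<rho>
  may vanish; log_q \<rho> is then minus infinity and such a condition holds for every s. Only the
  growth estimate has to treat this case apart: no abscissa is left to bound Re s from below, and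
  the bound comes instead from the eigenvalue 0 of \<open>C\<close>, whose distance condition keeps
  |q^s| at least \<delta>. The continuation gains exactly one unit because the right-hand side of
  the functional equation involves F only at s + 1, s + 2, and so on; in resummed form, removing the
  term k = 0 leaves increments of order 1/n. The resolvent depends on s only through q^s. Over a
  vertical strip of bounded width, away from the eigenvalues, q^s stays in a compact set (an annulus
  without discs around the eigenvalues), so the resolvent is bounded there uniformly in Im s and all
  growth comes from \<open>G\<close>.\<close>

declare qdigits.simps [simp del]

section \<open>Growth of the matrix products\<close>

lemma fnorm_nonneg [simp]: "0 \<le> fnorm M"
  unfolding fnorm_def by (intro real_sqrt_ge_zero sum_nonneg) auto

lemma fnorm_squared: "(fnorm M)\<^sup>2 = (\<Sum>i<dim_row M. \<Sum>j<dim_col M. (cmod (M $$ (i, j)))\<^sup>2)"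
  unfolding fnorm_def by (rule real_sqrt_pow2) (intro sum_nonneg, auto)

lemma norm_entry_le_fnorm:
  assumes "i < dim_row M" "j < dim_col M"
  shows "cmod (M $$ (i, j)) \<le> fnorm M"
proof -
  have "(cmod (M $$ (i, j)))\<^sup>2 \<le> (\<Sum>j<dim_col M. (cmod (M $$ (i, j)))\<^sup>2)"
    using assms by (intro member_le_sum) auto
  also have "\<dots> \<le> (\<Sum>i<dim_row M. \<Sum>j<dim_col M. (cmod (M $$ (i, j)))\<^sup>2)"
    using assms by (intro member_le_sum[where f = "\<lambda>i. \<Sum>j<dim_col M. (cmod (M $$ (i, j)))\<^sup>2"])
      (auto intro: sum_nonneg)
  finally show ?thesis by (simp add: fnorm_squared[symmetric] power2_le_iff_abs_le)
qed

text \<open>Cauchy-Schwarz bounds each entry by a row norm of \<open>M\<close> times a column norm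
  of \<open>N\<close>; summed over all entries, the double sum factors.\<close>

lemma fnorm_mult:
  assumes "dim_col M = dim_row N"
  shows "fnorm (M * N) \<le> fnorm M * fnorm N"
proof -
  define n where "n = dim_row N"
  have entry: "(cmod ((M * N) $$ (i, j)))\<^sup>2 \<le>
      (\<Sum>k<n. (cmod (M $$ (i, k)))\<^sup>2) * (\<Sum>k<n. (cmod (N $$ (k, j)))\<^sup>2)"
    if "i < dim_row M" "j < dim_col N" for i j
  proof -
    have "(M * N) $$ (i, j) = (\<Sum>k<n. M $$ (i, k) * N $$ (k, j))"
      using that assms by (simp add: scalar_prod_def n_def lessThan_atLeast0)
    hence "cmod ((M * N) $$ (i, j)) \<le> (\<Sum>k<n. cmod (M $$ (i, k)) * cmod (N $$ (k, j)))"
      by (metis (no_types, lifting) norm_mult norm_sum sum.cong)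
    hence "(cmod ((M * N) $$ (i, j)))\<^sup>2 \<le> (\<Sum>k<n. cmod (M $$ (i, k)) * cmod (N $$ (k, j)))\<^sup>2"
      by (intro power_mono) auto
    also have "\<dots> \<le> (\<Sum>k<n. (cmod (M $$ (i, k)))\<^sup>2) * (\<Sum>k<n. (cmod (N $$ (k, j)))\<^sup>2)"
      by (rule Cauchy_Schwarz_ineq_sum)
    finally show ?thesis .
  qed
  have M: "(fnorm M)\<^sup>2 = (\<Sum>i<dim_row M. \<Sum>k<n. (cmod (M $$ (i, k)))\<^sup>2)"
    unfolding fnorm_squared n_def assms ..
  have N: "(fnorm N)\<^sup>2 = (\<Sum>j<dim_col N. \<Sum>k<n. (cmod (N $$ (k, j)))\<^sup>2)"
    unfolding fnorm_squared n_def by (rule sum.swap)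
  have "(fnorm (M * N))\<^sup>2 = (\<Sum>i<dim_row M. \<Sum>j<dim_col N. (cmod ((M * N) $$ (i, j)))\<^sup>2)"
    by (simp only: fnorm_squared index_mult_mat(2,3))
  also have "\<dots> \<le> (\<Sum>i<dim_row M. \<Sum>j<dim_col N.
      (\<Sum>k<n. (cmod (M $$ (i, k)))\<^sup>2) * (\<Sum>k<n. (cmod (N $$ (k, j)))\<^sup>2))"
    by (intro sum_mono entry) auto
  also have "\<dots> = (fnorm M)\<^sup>2 * (fnorm N)\<^sup>2"
    unfolding M N by (rule sum_product[symmetric])
  finally have "(fnorm (M * N))\<^sup>2 \<le> (fnorm M * fnorm N)\<^sup>2" by (simp add: power_mult_distrib)
  thus ?thesis by (rule power2_le_imp_le) simp
qed

lemma mprod_Nil [simp]: "mprod d A [] = 1\<^sub>m d"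
  and mprod_Cons [simp]: "mprod d A (r # rs) = A r * mprod d A rs"
  by (simp_all add: mprod_def)

lemma mat_mult_entry:
  assumes "M \<in> carrier_mat a n" "N \<in> carrier_mat n b" "i < a" "j < b"
  shows "(M * N) $$ (i, j) = (\<Sum>k<n. M $$ (i, k) * N $$ (k, j))"
  using assms by (simp add: scalar_prod_def lessThan_atLeast0)

section \<open>Products over digit words and their exponential growth rate\<close>

locale regular_matrix_sequence =
  fixes q d n0 :: nat and A :: "nat \<Rightarrow> complex mat"
  assumes q: "q \<ge> 2" and d: "d \<ge> 1" and A: "\<And>r. r < q \<Longrightarrow> A r \<in> carrier_mat d d" and n0: "n0 \<ge> 1"
begin

abbreviation "\<rho> \<equiv> jsr q d A"
abbreviation "f \<equiv> regf q d A"
abbreviation "C \<equiv> sumA q d A"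
abbreviation "F \<equiv> dirF q d A n0"
abbreviation "G \<equiv> dirG q d A n0"

text \<open>The index set of the supremum in \<open>jsr\<close>. Being finite, it makes that
  supremum an upper bound for each of its words.\<close>

definition words :: "nat \<Rightarrow> nat list set" where
  "words l = {rs. length rs = l \<and> set rs \<subseteq> {..<q}}"

lemma finite_words: "finite (words l)"
  using finite_lists_length_eq[of "{..<q}" l] by (simp add: words_def conj_commute)

lemma words_nonempty: "words l \<noteq> {}"
proof -
  have "replicate l 0 \<in> words l" using q by (auto simp: words_def)
  thus ?thesis by blast
qed

lemma words_Suc: "words (Suc l) = (\<lambda>(r, rs). r # rs) ` ({..<q} \<times> words l)"
  by (auto simp: words_def length_Suc_conv image_iff)

lemma card_words: "card (words l) = q ^ l"
  using card_lists_length_eq[of "{..<q}" l] by (simp add: words_def conj_commute)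

lemma mprod_carrier: "set rs \<subseteq> {..<q} \<Longrightarrow> mprod d A rs \<in> carrier_mat d d"
  by (induction rs) (use A in \<open>auto intro!: mult_carrier_mat\<close>)

lemma mprod_append:
  assumes "set rs \<subseteq> {..<q}" "set ts \<subseteq> {..<q}"
  shows "mprod d A (rs @ ts) = mprod d A rs * mprod d A ts"
  using assms(1)
proof (induction rs)
  case Nil
  thus ?case using mprod_carrier[OF assms(2)] by simp
next
  case (Cons r rs)
  thus ?case using assoc_mult_mat[OF A mprod_carrier mprod_carrier[OF assms(2)], of r rs]
    by simp
qed

lemma fnorm_mprod_append:
  assumes "set rs \<subseteq> {..<q}" "set ts \<subseteq> {..<q}"
  shows "fnorm (mprod d A (rs @ ts)) \<le> fnorm (mprod d A rs) * fnorm (mprod d A ts)"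
  unfolding mprod_append[OF assms] using mprod_carrier assms
  by (intro fnorm_mult) (metis carrier_matD)

text \<open>An infimum of reals carries information only for a family bounded below; with this,
  \<open>\<rho> < R\<close> yields a length whose supremum is below \<open>R\<close>.\<close>

lemma bdd_below_jsr: "bdd_below ((\<lambda>l. SUP rs \<in> words l. fnorm (mprod d A rs) powr (1 / real l)) ` {1..})"
proof (rule bdd_belowI2)
  fix l :: nat
  obtain rs where rs: "rs \<in> words l" using words_nonempty by blast
  have "0 \<le> fnorm (mprod d A rs) powr (1 / real l)" by simp
  also have "\<dots> \<le> (SUP rs \<in> words l. fnorm (mprod d A rs) powr (1 / real l))"
    using rs finite_words by (intro cSUP_upper) auto
  finally show "0 \<le> (SUP rs \<in> words l. fnorm (mprod d A rs) powr (1 / real l))" .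
qed

lemma jsr_nonneg: "0 \<le> \<rho>"
  unfolding jsr_def words_def[symmetric]
proof (rule cINF_greatest)
  fix l :: nat
  obtain rs where rs: "rs \<in> words l" using words_nonempty by blast
  have "0 \<le> fnorm (mprod d A rs) powr (1 / real l)" by simp
  also have "\<dots> \<le> (SUP rs \<in> words l. fnorm (mprod d A rs) powr (1 / real l))"
    using rs finite_words by (intro cSUP_upper) auto
  finally show "0 \<le> (SUP rs \<in> words l. fnorm (mprod d A rs) powr (1 / real l))" .
qed auto

text \<open>Some block length \<open>l\<close> has all its words of norm at most
  \<open>R ^ l\<close>. A long word is cut into such blocks; the last piece, shorter than
  \<open>l\<close>, lies in a finite set and costs a constant.\<close>

lemma fnorm_mprod_bound:
  assumes "\<rho> < R"
  obtains c where "0 < c" "\<And>rs. set rs \<subseteq> {..<q} \<Longrightarrow> fnorm (mprod d A rs) \<le> c * R ^ length rs"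
proof -
  have R: "0 < R" using assms jsr_nonneg by linarith
  obtain l where l: "1 \<le> l" "(SUP rs \<in> words l. fnorm (mprod d A rs) powr (1 / real l)) < R"
    using assms bdd_below_jsr unfolding jsr_def words_def[symmetric]
    by (auto simp: cINF_less_iff)
  have block: "fnorm (mprod d A rs) \<le> R ^ l" if "rs \<in> words l" for rs
  proof -
    have "fnorm (mprod d A rs) powr (1 / real l) \<le>
        (SUP rs \<in> words l. fnorm (mprod d A rs) powr (1 / real l))"
      using that finite_words by (intro cSUP_upper) auto
    also note l(2)
    finally have "(fnorm (mprod d A rs) powr (1 / real l)) powr real l \<le> R powr real l"
      by (intro powr_mono2) auto
    thus ?thesis using l(1) R by (simp add: powr_powr powr_realpow)
  qed
  define W where "W = (\<Union>e<l. words e)"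
  \<comment> \<open>The empty word makes the maximum nonnegative, so the added 1 gives
    \<open>0 < c\<close>.\<close>
  define c where "c = Max ((\<lambda>rs. fnorm (mprod d A rs) / R ^ length rs) ` W) + 1"
  have finW: "finite W" unfolding W_def using finite_words by blast
  have short: "fnorm (mprod d A rs) / R ^ length rs \<le> c - 1"
    if "set rs \<subseteq> {..<q}" "length rs < l" for rs
    unfolding c_def using finW that by (simp, intro Max_ge) (auto simp: W_def words_def)
  have c: "0 < c"
  proof -
    have "0 \<le> fnorm (mprod d A []) / R ^ length ([] :: nat list)" by simp
    also have "\<dots> \<le> c - 1" using l(1) by (intro short) auto
    finally show ?thesis by simp
  qed
  have "fnorm (mprod d A rs) \<le> c * R ^ length rs" if "set rs \<subseteq> {..<q}" for rs
    using that
  proof (induction rs rule: length_induct)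
    case (1 rs)
    show ?case
    proof (cases "length rs < l")
      case True
      have "fnorm (mprod d A rs) / R ^ length rs \<le> c"
        using short[OF "1.prems" True] by linarith
      thus ?thesis using R by (simp add: divide_simps)
    next
      case False
      define us where "us = take l rs"
      define ts where "ts = drop l rs"
      have rs: "rs = us @ ts" by (simp add: us_def ts_def)
      have len: "length us = l" "length ts < length rs" using False l(1) by (auto simp: us_def ts_def)
      have sets: "set us \<subseteq> {..<q}" "set ts \<subseteq> {..<q}" using "1.prems" rs by auto
      have "fnorm (mprod d A rs) \<le> fnorm (mprod d A us) * fnorm (mprod d A ts)"
        unfolding rs by (rule fnorm_mprod_append[OF sets])
      also have "\<dots> \<le> R ^ l * (c * R ^ length ts)"
        using "1.IH" len sets R by (intro mult_mono block) (auto simp: words_def)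
      also have "\<dots> = c * R ^ length rs" using len by (simp add: rs power_add)
      finally show ?thesis .
    qed
  qed
  thus thesis using that c by blast
qed

section \<open>Digit expansions and the polynomial growth of \<open>f\<close>\<close>

lemma qdigits_step: "0 < n \<Longrightarrow> qdigits q n = n mod q # qdigits q (n div q)"
  using q by (subst qdigits.simps) auto

lemma qdigits_0 [simp]: "qdigits q 0 = []"
  by (subst qdigits.simps) auto

lemma set_qdigits: "set (qdigits q n) \<subseteq> {..<q}"
proof (induction n rule: less_induct)
  case (less n)
  show ?case
  proof (cases "n = 0")
    case False
    thus ?thesis using less.IH[of "n div q"] q by (auto simp: qdigits_step)
  qed simp
qed

text \<open>For the length L, the second inequality expresses \<open>q ^ (L - 1) \<le> n\<close>
  without truncated subtraction. Together they put \<open>q ^ L / n\<close> between 1 and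
  \<open>q\<close>.\<close>

lemma qdigits_length_bounds:
  assumes "0 < n"
  shows "n < q ^ length (qdigits q n)" "q ^ length (qdigits q n) \<le> q * n"
proof -
  have "n < q ^ length (qdigits q n) \<and> q ^ length (qdigits q n) \<le> q * n"
    using assms
  proof (induction n rule: less_induct)
    case (less n)
    show ?case
    proof (cases "n div q = 0")
      case True
      hence "n < q" using q by (simp add: div_eq_0_iff)
      thus ?thesis using less.prems by (simp add: qdigits_step)
    next
      case False
      let ?m = "n div q"
      let ?L = "q ^ length (qdigits q ?m)"
      have IH: "?m < ?L" "?L \<le> q * ?m" using less False q by auto
      have "n < q * Suc ?m" using q by (simp add: dividend_less_times_div)
      also have "\<dots> \<le> q * ?L" using IH(1) by (intro mult_left_mono) auto
      finally have "n < q * ?L" .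
      moreover have "q * ?m \<le> n" by simp
      hence "?L \<le> n" using IH(2) by linarith
      hence "q * ?L \<le> q * n" by simp
      ultimately show ?thesis using less.prems by (simp add: qdigits_step)
    qed
  qed
  thus "n < q ^ length (qdigits q n)" "q ^ length (qdigits q n) \<le> q * n" by auto
qed

lemma f_carrier: "f n \<in> carrier_mat d d"
  unfolding regf_def by (rule mprod_carrier[OF set_qdigits])

text \<open>Digits are listed from the least significant one, so a new lowest digit multiplies from
  the left. Positivity of \<open>n\<close> excludes \<open>q * n + r = 0\<close>, whose empty
  expansion does not record the digit 0.\<close>

lemma f_step:
  assumes "0 < n" "r < q"
  shows "f (q * n + r) = A r * f n"
proof -
  have "0 < q * n + r" using assms q by simp
  thus ?thesis unfolding regf_def using assms by (subst qdigits_step) auto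
qed

lemma fnorm_f_bound:
  assumes "\<rho> < real q powr t"
  obtains c where "0 < c" "\<And>n. 0 < n \<Longrightarrow> fnorm (f n) \<le> c * real n powr t"
proof -
  obtain c where c: "0 < c"
    "\<And>rs. set rs \<subseteq> {..<q} \<Longrightarrow> fnorm (mprod d A rs) \<le> c * (real q powr t) ^ length rs"
    using fnorm_mprod_bound[OF assms] by metis
  \<comment> \<open>The exponent \<open>t\<close> may be negative, so \<open>K\<close> has to bound
    \<open>u powr t\<close> on \<open>1 \<le> u \<le> q\<close> for either sign.\<close>
  define K where "K = max 1 (real q powr t)"
  have "fnorm (f n) \<le> (c * K) * real n powr t" if n: "0 < n" for n
  proof -
    define L where "L = length (qdigits q n)"
    have L: "real n < real q ^ L" "real q ^ L \<le> real q * real n"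
      using qdigits_length_bounds[OF n]
       apply (metis L_def of_nat_less_iff of_nat_power)
      by (metis L_def \<open>q ^ length (qdigits q n) \<le> q * n\<close> of_nat_le_iff of_nat_mult of_nat_power)
    define u where "u = real q ^ L / real n"
    have u: "1 \<le> u" "u \<le> real q" using L n by (auto simp: u_def field_simps)
    have "u powr t \<le> K"
    proof (cases "0 \<le> t")
      case True
      hence "u powr t \<le> real q powr t" using u by (intro powr_mono2) auto
      thus ?thesis by (simp add: K_def)
    next
      case False
      hence "u powr t \<le> u powr 0" using u by (intro powr_mono) auto
      thus ?thesis using u by (simp add: K_def)
    qed
    have "(real q powr t) ^ L = (real q ^ L) powr t"
      using q by (simp add: powr_powr powr_realpow[symmetric] mult.commute)
    also have "real q ^ L = u * real n" using n by (simp add: u_def)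
    also have "(u * real n) powr t = u powr t * real n powr t"
      by (rule powr_mult)
    also have "\<dots> \<le> K * real n powr t" using \<open>u powr t \<le> K\<close> by (intro mult_right_mono) auto
    finally have *: "(real q powr t) ^ L \<le> K * real n powr t" .
    have "fnorm (f n) \<le> c * (real q powr t) ^ L"
      unfolding regf_def L_def by (rule c(2)[OF set_qdigits])
    also have "\<dots> \<le> c * (K * real n powr t)" using * c(1) by (intro mult_left_mono) auto
    finally show ?thesis by (simp add: mult_ac)
  qed
  moreover have "0 < c * K" using c(1) by (simp add: K_def)
  ultimately show thesis using that by blast
qed

text \<open>With exponent \<open>\<sigma> - 1\<close> itself, the comparison series for the
  Dirichlet series at \<open>\<sigma>\<close> would be harmonic; the strict inequality leaves room
  for a smaller exponent.\<close>

lemma smaller_exponent: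
  assumes "\<rho> < real q powr t"
  obtains t' where "t' < t" "\<rho> < real q powr t'"
proof -
  obtain R where R: "\<rho> < R" "R < real q powr t" using dense[OF assms] by blast
  have R0: "0 < R" using R jsr_nonneg by linarith
  have "log (real q) R < t" using R R0 q by (simp add: log_less_iff)
  moreover have "real q powr log (real q) R = R" using R0 q by simp
  ultimately show thesis using that[of "log (real q) R"] R by simp
qed

lemma summable_fnorm:
  assumes "\<rho> < real q powr (\<sigma> - 1)"
  shows "summable (\<lambda>k. real (k + n0) powr (-\<sigma>) * fnorm (f (k + n0)))"
proof -
  obtain t where t: "t < \<sigma> - 1" "\<rho> < real q powr t" using smaller_exponent[OF assms] .
  obtain c where c: "0 < c" "\<And>n. 0 < n \<Longrightarrow> fnorm (f n) \<le> c * real n powr t"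
    using fnorm_f_bound[OF t(2)] by blast
  have "summable (\<lambda>n. real n powr (t - \<sigma>))" using t by (simp add: summable_real_powr_iff)
  hence "summable (\<lambda>k. c * real (k + n0) powr (t - \<sigma>))"
    by (intro summable_mult) (subst summable_iff_shift)
  thus ?thesis
  proof (rule summable_comparison_test'[where N = 0])
    fix k :: nat
    have pos: "0 < k + n0" using n0 by simp
    have "real (k + n0) powr (-\<sigma>) * fnorm (f (k + n0)) \<le>
        real (k + n0) powr (-\<sigma>) * (c * real (k + n0) powr t)"
      using c(2)[OF pos] by (intro mult_left_mono) auto
    also have "\<dots> = c * (real (k + n0) powr (-\<sigma>) * real (k + n0) powr t)" by (simp add: mult_ac)
    also have "\<dots> = c * real (k + n0) powr (t - \<sigma>)"
      by (simp add: powr_add[symmetric])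
    finally show "norm (real (k + n0) powr (-\<sigma>) * fnorm (f (k + n0))) \<le> c * real (k + n0) powr (t - \<sigma>)"
      by simp
  qed
qed

end

section \<open>Convergence of the series\<close>

text \<open>The product majorant makes the family absolutely summable over pairs, where unordered
  sums may be interchanged; \<open>inf_eq\<close> translates back to ordered series.\<close>

lemma suminf_swap_product_bound:
  fixes g :: "nat \<Rightarrow> nat \<Rightarrow> complex"
  assumes le: "\<And>k m. norm (g k m) \<le> a k * b m"
    and a: "summable a" "\<And>k. 0 \<le> a k" and b: "summable b" "\<And>m. 0 \<le> b m"
  shows "(\<Sum>k. \<Sum>m. g k m) = (\<Sum>m. \<Sum>k. g k m)" "summable (\<lambda>m. norm (\<Sum>k. g k m))"
proof -
  have hb: "((\<lambda>m. a k * b m) has_sum (a k * suminf b)) UNIV" for k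
    using b by (intro has_sum_cmult_right sums_nonneg_imp_has_sum) (auto simp: summable_sums)
  have "(\<lambda>(k, m). a k * b m) summable_on (UNIV \<times> UNIV)"
  proof (rule summable_on_SigmaI)
    show "(\<lambda>k. a k * suminf b) summable_on UNIV"
      using a b by (intro summable_nonneg_imp_summable_on summable_mult2) (auto simp: suminf_nonneg)
  qed (use hb a b in auto)
  hence "(\<lambda>x. norm (case x of (k, m) \<Rightarrow> g k m)) summable_on (UNIV \<times> UNIV)"
    by (rule Infinite_Sum.abs_summable_on_comparison_test') (use le in auto)
  hence sum2: "(\<lambda>(k, m). g k m) summable_on (UNIV \<times> UNIV)"
    by (rule abs_summable_summable)
  have row: "summable (\<lambda>m. norm (g k m))" for k
    by (rule summable_comparison_test'[OF summable_mult[OF b(1), of "a k"], where N = 0])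
      (use le in auto)
  have col: "summable (\<lambda>k. norm (g k m))" for m
    by (rule summable_comparison_test'[OF summable_mult2[OF a(1), of "b m"], where N = 0])
      (use le in auto)
  have row_le: "norm (\<Sum>m. g k m) \<le> a k * suminf b" for k
  proof -
    have "norm (\<Sum>m. g k m) \<le> (\<Sum>m. norm (g k m))" by (rule summable_norm[OF row])
    also have "\<dots> \<le> (\<Sum>m. a k * b m)" by (rule suminf_le[OF le row summable_mult[OF b(1)]])
    finally show ?thesis by (simp add: suminf_mult b)
  qed
  have col_le: "norm (\<Sum>k. g k m) \<le> suminf a * b m" for m
  proof -
    have "norm (\<Sum>k. g k m) \<le> (\<Sum>k. norm (g k m))" by (rule summable_norm[OF col])
    also have "\<dots> \<le> (\<Sum>k. a k * b m)" by (rule suminf_le[OF le col summable_mult2[OF a(1)]])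
    finally show ?thesis by (simp add: suminf_mult2 a)
  qed
  have rows: "summable (\<lambda>k. norm (\<Sum>m. g k m))"
    by (rule summable_comparison_test'[OF summable_mult2[OF a(1), of "suminf b"], where N = 0])
      (use row_le in auto)
  show cols: "summable (\<lambda>m. norm (\<Sum>k. g k m))"
    by (rule summable_comparison_test'[OF summable_mult[OF b(1), of "suminf a"], where N = 0])
      (use col_le in auto)
  have inf_eq: "infsum h UNIV = suminf h" if "summable (\<lambda>n. norm (h n))" for h :: "nat \<Rightarrow> complex"
    by (rule infsumI, rule norm_summable_imp_has_sum[OF that])
      (use that in \<open>simp add: summable_norm_cancel summable_sums\<close>)
  show "(\<Sum>k. \<Sum>m. g k m) = (\<Sum>m. \<Sum>k. g k m)"
    using infsum_swap_banach[OF sum2] by (simp add: inf_eq row col rows cols)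
qed

text \<open>Up to sign the coefficient is the rising factorial of \<open>s\<close> over
  \<open>fact k\<close>, and each factor \<open>s + i\<close> has norm at most \<open>S + i\<close>.
  The majorant is, up to sign, the binomial coefficient for \<open>- S\<close>.\<close>

lemma norm_gbinomial_uminus_le:
  fixes s :: complex
  assumes "norm s \<le> S"
  shows "norm ((- s) gchoose k) \<le> pochhammer S k / fact k"
proof -
  have "norm (pochhammer s k) \<le> pochhammer S k"
    unfolding pochhammer_prod prod_norm[symmetric]
  proof (rule prod_mono)
    fix i :: nat
    have "norm (s + of_nat i) \<le> norm s + norm (of_nat i :: complex)" by (rule norm_triangle_ineq)
    thus "0 \<le> norm (s + of_nat i) \<and> norm (s + of_nat i) \<le> S + of_nat i" using assms by simp
  qed
  thus ?thesis by (simp add: gbinomial_pochhammer norm_mult norm_divide norm_power divide_right_mono)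
qed

text \<open>This is the binomial series of \<open>(1 - x) powr (- S)\<close>: the signs of its
  coefficients and of \<open>(- x) ^ k\<close> cancel.\<close>

lemma summable_pochhammer_power:
  fixes S x :: real
  assumes "\<bar>x\<bar> < 1"
  shows "summable (\<lambda>k. pochhammer S k / fact k * x ^ k)"
proof -
  have "summable (\<lambda>k. ((- S) gchoose k) * (- x) ^ k)"
    using gen_binomial_real[of "- x" "- S"] assms by (simp add: sums_iff)
  moreover have "((- S) gchoose k) * (- x) ^ k = pochhammer S k / fact k * x ^ k" for k
  proof -
    have "(- 1 :: real) ^ k * (- 1) ^ k = 1" by (simp flip: power_mult_distrib)
    thus ?thesis unfolding gbinomial_pochhammer power_minus[of x] by (simp add: field_simps)
  qed
  ultimately show ?thesis by simp
qed

lemma open_halfplane: "open {s. \<rho> < real q powr (Re s - a)}" if "q \<ge> 1"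
  using that by (intro open_Collect_less continuous_intros) auto

lemma norm_of_nat_powr: "norm ((of_nat n :: complex) powr s) = real n powr Re s"
  by (simp add: norm_powr_real_powr)

lemma const_powr_uminus_holomorphic:
  assumes "z \<noteq> 0"
  shows "(\<lambda>s. z powr (- s)) holomorphic_on X"
  unfolding powr_def using assms by (simp) (intro holomorphic_intros)

context regular_matrix_sequence
begin

lemma halfplane_mono:
  assumes "\<rho> < real q powr s" "s \<le> s'"
  shows "\<rho> < real q powr s'"
proof -
  have "real q powr s \<le> real q powr s'" using assms q by (intro powr_mono) auto
  thus ?thesis using assms by linarith
qed

text \<open>The real part attains its minimum on \<open>K\<close>, which provides one abscissa and
  hence one majorant for the Weierstrass test.\<close>

lemma compact_halfplane:
  assumes "compact K" "K \<subseteq> {s. \<rho> < real q powr (Re s - a)}"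
  obtains \<sigma> where "\<rho> < real q powr (\<sigma> - a)" "\<And>s. s \<in> K \<Longrightarrow> \<sigma> \<le> Re s"
proof (cases "K = {}")
  case True
  \<comment> \<open>On the empty set any abscissa in the half-plane serves;
    \<open>\<rho> + 1\<close> is positive even if \<rho> vanishes, so its logarithm can be
    used.\<close>
  have "real q powr log (real q) (\<rho> + 1) = \<rho> + 1" using q jsr_nonneg by simp
  thus thesis using that[of "log (real q) (\<rho> + 1) + a"] True by simp
next
  case False
  have "continuous_on K Re" by (intro continuous_intros)
  then obtain s0 where "s0 \<in> K" "\<And>s. s \<in> K \<Longrightarrow> Re s0 \<le> Re s"
    using continuous_attains_inf[OF assms(1) False] by blast
  thus thesis using that[of "Re s0"] assms(2) by blast
qed

lemma norm_f_entry: "i < d \<Longrightarrow> j < d \<Longrightarrow> norm (f n $$ (i, j)) \<le> fnorm (f n)"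
  using f_carrier[of n] by (intro norm_entry_le_fnorm) auto

lemma norm_dterm_le:
  assumes "i < d" "j < d" "\<sigma> \<le> Re s"
  shows "norm (dterm q d A n0 i j k s) \<le> real (k + n0) powr (-\<sigma>) * fnorm (f (k + n0))"
proof -
  have "norm ((of_nat (k + n0) :: complex) powr (- s)) = real (k + n0) powr (- Re s)"
    unfolding norm_of_nat_powr by simp
  also have "\<dots> \<le> real (k + n0) powr (- \<sigma>)" using assms n0 by (intro powr_mono) auto
  finally show ?thesis unfolding dterm_def norm_mult
    by (intro mult_mono norm_f_entry assms) auto
qed

lemma dterm_summable:
  assumes "i < d" "j < d" "\<rho> < real q powr (Re s - 1)"
  shows "summable (\<lambda>k. norm (dterm q d A n0 i j k s))"
  by (rule summable_comparison_test'[OF summable_fnorm[OF assms(3)], where N = 0])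
    (use norm_dterm_le[OF assms(1,2) order_refl] in simp)

lemma F_entry: "i < d \<Longrightarrow> j < d \<Longrightarrow> F s $$ (i, j) = (\<Sum>k. dterm q d A n0 i j k s)"
  by (simp add: dirF_def)

lemma F_carrier: "F s \<in> carrier_mat d d"
  by (simp add: dirF_def)

text \<open>The bound is the same for all \<open>s\<close> to the right of \<open>\<sigma>\<close>,
  hence also for all the shifted arguments of the binomial series at once.\<close>

lemma norm_F_le:
  assumes "i < d" "j < d" "\<rho> < real q powr (\<sigma> - 1)" "\<sigma> \<le> Re s"
  shows "norm (F s $$ (i, j)) \<le> (\<Sum>k. real (k + n0) powr (-\<sigma>) * fnorm (f (k + n0)))"
proof -
  have sm: "summable (\<lambda>k. norm (dterm q d A n0 i j k s))"
    using assms halfplane_mono[OF assms(3), of "Re s - 1"] by (intro dterm_summable) auto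
  have "norm (F s $$ (i, j)) \<le> (\<Sum>k. norm (dterm q d A n0 i j k s))"
    unfolding F_entry[OF assms(1,2)] by (rule summable_norm[OF sm])
  also have "\<dots> \<le> (\<Sum>k. real (k + n0) powr (-\<sigma>) * fnorm (f (k + n0)))"
    by (rule suminf_le[OF norm_dterm_le[OF assms(1,2,4)] sm summable_fnorm[OF assms(3)]])
  finally show ?thesis .
qed

lemma dirichlet_series_uniform_limit:
  assumes "compact K" "K \<subseteq> {s. \<rho> < real q powr (Re s - 1)}" "i < d" "j < d"
  shows "uniform_limit K (\<lambda>N s. \<Sum>k<N. norm (dterm q d A n0 i j k s))
           (\<lambda>s. \<Sum>k. norm (dterm q d A n0 i j k s)) sequentially" (is ?abs)
    and "uniform_limit K (\<lambda>N s. \<Sum>k<N. dterm q d A n0 i j k s) (\<lambda>s. F s $$ (i, j)) sequentially" (is ?plain)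
proof -
  obtain \<sigma> where \<sigma>: "\<rho> < real q powr (\<sigma> - 1)" "\<And>s. s \<in> K \<Longrightarrow> \<sigma> \<le> Re s"
    using compact_halfplane[OF assms(1,2)] by blast
  show ?abs by (rule Weierstrass_m_test[OF _ summable_fnorm[OF \<sigma>(1)]])
    (use norm_dterm_le[OF assms(3,4) \<sigma>(2)] in simp)
  show ?plain unfolding F_entry[OF assms(3,4)]
    by (rule Weierstrass_m_test[OF _ summable_fnorm[OF \<sigma>(1)]])
      (use norm_dterm_le[OF assms(3,4) \<sigma>(2)] in simp)
qed

lemma F_holomorphic:
  assumes "i < d" "j < d"
  shows "(\<lambda>s. F s $$ (i, j)) holomorphic_on {s. \<rho> < real q powr (Re s - 1)}"
proof (rule holomorphic_uniform_sequence[where f = "\<lambda>N s. \<Sum>k<N. dterm q d A n0 i j k s"])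
  show op: "open {s. \<rho> < real q powr (Re s - 1)}" using q by (intro open_halfplane) auto
  show "(\<lambda>s. \<Sum>k<N. dterm q d A n0 i j k s) holomorphic_on {s. \<rho> < real q powr (Re s - 1)}" for N
    unfolding dterm_def using n0
    by (intro holomorphic_intros const_powr_uminus_holomorphic) (simp del: of_nat_add)
  fix z assume "z \<in> {s. \<rho> < real q powr (Re s - 1)}"
  then obtain e where "0 < e" "cball z e \<subseteq> {s. \<rho> < real q powr (Re s - 1)}"
    using op open_contains_cball by blast
  thus "\<exists>e>0. cball z e \<subseteq> {s. \<rho> < real q powr (Re s - 1)} \<and>
      uniform_limit (cball z e) (\<lambda>N s. \<Sum>k<N. dterm q d A n0 i j k s) (\<lambda>s. F s $$ (i, j)) sequentially"
    using dirichlet_series_uniform_limit(2)[OF compact_cball _ assms] by blast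
qed

text \<open>The norm series at a real abscissa; for
  \<open>\<rho> < real q powr (\<sigma> - 1)\<close> it dominates every entry of \<open>F\<close> on
  \<open>\<sigma> \<le> Re s\<close>.\<close>

definition Fbound :: "real \<Rightarrow> real" where
  "Fbound \<sigma> = (\<Sum>k. real (k + n0) powr (-\<sigma>) * fnorm (f (k + n0)))"

text \<open>The shift by at least 1 lands in the half-plane of absolute convergence. The factor
  \<open>F\<close> then has a bound free of \<open>k\<close>, and the ratio \<open>r / q < 1\<close>
  makes the majorant converge in \<open>k\<close>.\<close>

lemma norm_bterm_le:
  assumes "r < q" "i < d" "j < d" "\<rho> < real q powr \<sigma>" "\<sigma> \<le> Re s" "norm s \<le> S"
  shows "norm (bterm q d A n0 r i j k s) \<le>
    pochhammer S (Suc k) / fact (Suc k) * (real r / real q) ^ Suc k * Fbound (\<sigma> + 1)"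
proof -
  have binom: "norm ((- s) gchoose Suc k) \<le> pochhammer S (Suc k) / fact (Suc k)"
    by (rule norm_gbinomial_uminus_le[OF assms(6)])
  have F: "norm (F (s + of_nat (Suc k)) $$ (i, j)) \<le> Fbound (\<sigma> + 1)"
    unfolding Fbound_def using assms by (intro norm_F_le) auto
  have "0 \<le> pochhammer S (Suc k) / fact (Suc k)" using binom norm_ge_zero by (rule order_trans[rotated])
  thus ?thesis unfolding bterm_def norm_mult norm_power norm_divide norm_of_nat
    by (intro mult_mono binom F order_refl mult_nonneg_nonneg) auto
qed

lemma summable_bterm_majorant:
  assumes "r < q"
  shows "summable (\<lambda>k. pochhammer S (Suc k) / fact (Suc k) * (real r / real q) ^ Suc k * B)"
proof -
  have "\<bar>real r / real q\<bar> < 1" using assms by simp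
  from summable_pochhammer_power[OF this, of S] show ?thesis
    by (intro summable_mult2) (subst (asm) summable_Suc_iff[symmetric], assumption)
qed

lemma binser_entry: "i < d \<Longrightarrow> j < d \<Longrightarrow> binser q d A n0 r s $$ (i, j) = (\<Sum>k. bterm q d A n0 r i j k s)"
  by (simp add: binser_def)

lemma binser_carrier: "binser q d A n0 r s \<in> carrier_mat d d"
  by (simp add: binser_def)

lemma binomial_series_uniform_limit:
  assumes "compact K" "K \<subseteq> {s. \<rho> < real q powr Re s}" "r < q" "i < d" "j < d"
  shows "uniform_limit K (\<lambda>N s. \<Sum>k<N. norm (bterm q d A n0 r i j k s))
           (\<lambda>s. \<Sum>k. norm (bterm q d A n0 r i j k s)) sequentially" (is ?abs)
    and "uniform_limit K (\<lambda>N s. \<Sum>k<N. bterm q d A n0 r i j k s)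
           (\<lambda>s. binser q d A n0 r s $$ (i, j)) sequentially" (is ?plain)
proof -
  obtain \<sigma> where \<sigma>: "\<rho> < real q powr \<sigma>" "\<And>s. s \<in> K \<Longrightarrow> \<sigma> \<le> Re s"
    using compact_halfplane[OF assms(1), of 0] assms(2) by auto
  obtain S where S: "\<And>s. s \<in> K \<Longrightarrow> norm s \<le> S"
    using compact_imp_bounded[OF assms(1)] unfolding bounded_iff by blast
  note le = norm_bterm_le[OF assms(3-5) \<sigma> S]
  show ?abs by (rule Weierstrass_m_test[OF _ summable_bterm_majorant[OF assms(3)]]) (use le in simp)
  show ?plain unfolding binser_entry[OF assms(4,5)]
    by (rule Weierstrass_m_test[OF _ summable_bterm_majorant[OF assms(3)]]) (use le in simp)
qed

lemma gbinomial_uminus_holomorphic: "(\<lambda>s. (- s) gchoose k) holomorphic_on X"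
  unfolding gbinomial_prod_rev by (intro holomorphic_intros) auto

lemma binser_holomorphic:
  assumes "r < q" "i < d" "j < d"
  shows "(\<lambda>s. binser q d A n0 r s $$ (i, j)) holomorphic_on {s. \<rho> < real q powr Re s}"
proof (rule holomorphic_uniform_sequence[where f = "\<lambda>N s. \<Sum>k<N. bterm q d A n0 r i j k s"])
  show op: "open {s. \<rho> < real q powr Re s}" using q open_halfplane[of q \<rho> 0] by auto
  have Fh: "(\<lambda>s. F (s + of_nat (Suc k)) $$ (i, j)) holomorphic_on {s. \<rho> < real q powr Re s}" for k
  proof -
    have "(\<lambda>s. F s $$ (i, j)) \<circ> (\<lambda>s. s + of_nat (Suc k)) holomorphic_on {s. \<rho> < real q powr Re s}"
    proof (rule holomorphic_on_compose_gen[OF _ F_holomorphic[OF assms(2,3)]])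
      show "(\<lambda>s. s + of_nat (Suc k)) ` {s. \<rho> < real q powr Re s} \<subseteq> {s. \<rho> < real q powr (Re s - 1)}"
        using halfplane_mono by auto
    qed (intro holomorphic_intros)
    thus ?thesis by (simp add: o_def)
  qed
  show "(\<lambda>s. \<Sum>k<N. bterm q d A n0 r i j k s) holomorphic_on {s. \<rho> < real q powr Re s}" for N
    unfolding bterm_def by (intro holomorphic_intros Fh gbinomial_uminus_holomorphic)
  fix z assume "z \<in> {s. \<rho> < real q powr Re s}"
  then obtain e where "0 < e" "cball z e \<subseteq> {s. \<rho> < real q powr Re s}"
    using op open_contains_cball by blast
  thus "\<exists>e>0. cball z e \<subseteq> {s. \<rho> < real q powr Re s} \<and>
      uniform_limit (cball z e) (\<lambda>N s. \<Sum>k<N. bterm q d A n0 r i j k s)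
        (\<lambda>s. binser q d A n0 r s $$ (i, j)) sequentially"
    using binomial_series_uniform_limit(2)[OF compact_cball _ assms] by blast
qed

end

section \<open>The functional equation\<close>

context regular_matrix_sequence
begin

text \<open>The subtracted 1 is the term \<open>k = 0\<close> missing from \<open>binser\<close>. It
  makes the middle factor of order 1/n, so the sum over \<open>m\<close> converges one unit further
  left than the Dirichlet series.\<close>

definition tterm :: "nat \<Rightarrow> nat \<Rightarrow> nat \<Rightarrow> nat \<Rightarrow> complex \<Rightarrow> complex" where
  "tterm r i j m s = of_nat (m + n0) powr (- s) *
     ((1 + of_nat r / (of_nat q * of_nat (m + n0))) powr (- s) - 1) * (f (m + n0) $$ (i, j))"

text \<open>Interchange of a double series: for fixed \<open>k\<close> the sum over \<open>m\<close>
  is a \<open>bterm\<close>, and for fixed \<open>m\<close> the sum over \<open>k\<close> is a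
  binomial series at \<open>r / (q n)\<close> without its first term.\<close>

lemma binser_eq_suminf:
  assumes "r < q" "i < d" "j < d" "\<rho> < real q powr Re s"
  shows "binser q d A n0 r s $$ (i, j) = (\<Sum>m. tterm r i j m s)"
    and "summable (\<lambda>m. norm (tterm r i j m s))"
proof -
  define g where "g k m = ((- s) gchoose Suc k) * (of_nat r / of_nat q) ^ Suc k *
    dterm q d A n0 i j m (s + of_nat (Suc k))" for k m
  define a where "a k = pochhammer (norm s) (Suc k) / fact (Suc k) * (real r / real q) ^ Suc k" for k
  \<comment> \<open>Of the decay of n with exponent Re s + k + 1 only Re s + 1 is kept. Since n is
    at least 1 this is a majorant, and it separates \<open>k\<close> from \<open>m\<close>.\<close>
  define b where "b m = real (m + n0) powr (- (Re s + 1)) * fnorm (f (m + n0))" for m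
  have a0: "0 \<le> a k" for k
  proof -
    have "0 \<le> pochhammer (norm s) (Suc k) / fact (Suc k)"
      using norm_gbinomial_uminus_le[OF order_refl, of s "Suc k"] norm_ge_zero
      by (rule order_trans[rotated])
    thus ?thesis unfolding a_def by (intro mult_nonneg_nonneg) auto
  qed
  have "norm (g k m) \<le> a k * b m" for k m
    unfolding g_def norm_mult norm_power norm_divide norm_of_nat a_def b_def
    using a0[of k] norm_gbinomial_uminus_le[OF order_refl, of s "Suc k"]
    by (intro mult_mono norm_dterm_le assms order_refl)
       (auto simp: a_def intro: order_trans[OF norm_ge_zero])
  moreover have "summable a"
    using summable_bterm_majorant[OF assms(1), of "norm s" 1] by (simp only: a_def[abs_def] mult_1_right)
  moreover have "summable b"
    unfolding b_def[abs_def] using assms(4) by (intro summable_fnorm) simp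
  moreover have "0 \<le> b m" for m by (simp add: b_def)
  ultimately have swap: "(\<Sum>k. \<Sum>m. g k m) = (\<Sum>m. \<Sum>k. g k m)"
    and abs: "summable (\<lambda>m. norm (\<Sum>k. g k m))"
    using suminf_swap_product_bound[of g a b] a0 by auto
  have rows: "(\<Sum>m. g k m) = bterm q d A n0 r i j k s" for k
  proof -
    have "\<rho> < real q powr (Re (s + of_nat (Suc k)) - 1)"
      using halfplane_mono[OF assms(4), of "Re s + real k"] by simp
    have "summable (\<lambda>m. dterm q d A n0 i j m (s + of_nat (Suc k)))"
      by (rule summable_norm_cancel[OF dterm_summable[OF assms(2,3)
            \<open>\<rho> < real q powr (Re (s + of_nat (Suc k)) - 1)\<close>]])
    thus ?thesis unfolding g_def bterm_def F_entry[OF assms(2,3)] by (rule suminf_mult)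
  qed
  have cols: "(\<Sum>k. g k m) = tterm r i j m s" for m
  proof -
    define n where "n = m + n0"
    have n: "0 < n" using n0 by (simp add: n_def)
    define z :: complex where "z = of_nat r / (of_nat q * of_nat n)"
    have "q * 1 \<le> q * n" using n by (intro mult_le_mono2) simp
    hence "r < q * n" using assms(1) by linarith
    hence "real r < real q * real n" by (simp flip: of_nat_mult)
    hence "norm z < 1" using n q by (simp add: z_def norm_divide norm_mult)
    hence "(\<lambda>k. ((- s) gchoose k) * z ^ k) sums (1 + z) powr (- s)"
      by (rule gen_binomial_complex)
    from sums_split_initial_segment[OF this, of 1]
    have "(\<lambda>k. ((- s) gchoose Suc k) * z ^ Suc k) sums ((1 + z) powr (- s) - 1)" by simp
    from sums_mult[OF this, of "of_nat n powr (- s) * (f n $$ (i, j))"]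
    have "(\<lambda>k. (of_nat n powr (- s) * (f n $$ (i, j))) * (((- s) gchoose Suc k) * z ^ Suc k))
      sums (of_nat n powr (- s) * (f n $$ (i, j)) * ((1 + z) powr (- s) - 1))" .
    moreover have "(of_nat n powr (- s) * (f n $$ (i, j))) * (((- s) gchoose Suc k) * z ^ Suc k) = g k m" for k
    proof -
      have "(of_nat n :: complex) powr (- (s + of_nat (Suc k))) =
          of_nat n powr (- s) * of_nat n powr (- of_nat (Suc k))"
        by (simp only: minus_add_distrib powr_add)
      also have "(of_nat n :: complex) powr (- of_nat (Suc k)) = inverse (of_nat n ^ Suc k)"
        using n by (simp only: powr_minus powr_complexpow of_nat_eq_0_iff)
      finally have 1: "(of_nat n :: complex) powr (- (s + of_nat (Suc k))) =
          of_nat n powr (- s) / of_nat n ^ Suc k" by (simp only: divide_inverse)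
      have "z = of_nat r / of_nat q / of_nat n" by (simp add: z_def)
      hence 2: "z ^ Suc k = (of_nat r / of_nat q) ^ Suc k / of_nat n ^ Suc k"
        by (simp only: power_divide)
      show ?thesis unfolding g_def dterm_def n_def[symmetric] 1 2
        by (simp only: mult_ac times_divide_eq_right times_divide_eq_left)
    qed
    ultimately show ?thesis
      by (simp add: sums_iff tterm_def n_def z_def mult_ac)
  qed
  show "binser q d A n0 r s $$ (i, j) = (\<Sum>m. tterm r i j m s)"
    unfolding binser_entry[OF assms(2,3)] using swap by (simp add: rows cols)
  show "summable (\<lambda>m. norm (tterm r i j m s))" using abs by (simp add: cols)
qed

text \<open>Complex powers do not split over products in general; here all bases are positive reals,
  so no branch of the logarithm intervenes.\<close>

lemma powr_digit_shift:
  assumes "0 < n"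
  shows "(of_nat (q * n + r) :: complex) powr (- s) =
    of_nat q powr (- s) * (of_nat n powr (- s) * (1 + of_nat r / (of_nat q * of_nat n)) powr (- s))"
proof -
  have "(of_nat (q * n + r) :: complex) = of_real (real q * (real n * (1 + real r / (real q * real n))))"
    using assms q by (simp add: field_simps)
  also have "\<dots> powr (- s) = of_real (real q) powr (- s) * (of_real (real n) powr (- s) *
      of_real (1 + real r / (real q * real n)) powr (- s))"
    by (simp add: powr_times_real add_nonneg_nonneg del: of_real_add)
  finally show ?thesis by simp
qed

lemma dterm_digit_shift:
  assumes "r < q" "i < d" "j < d"
  shows "dterm q d A n0 i j (m * q + r + (q - 1) * n0) s =
    (\<Sum>l<d. A r $$ (i, l) * (of_nat q powr (- s) * (tterm r l j m s + dterm q d A n0 l j m s)))"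
proof -
  define n where "n = m + n0"
  have n: "0 < n" using n0 by (simp add: n_def)
  \<comment> \<open>The index of a \<open>dterm\<close> is its integer minus \<open>n0\<close>,
    whence the offset \<open>(q - 1) * n0\<close>.\<close>
  have index: "m * q + r + (q - 1) * n0 + n0 = q * n + r"
    using q by (cases q) (auto simp: n_def algebra_simps)
  \<comment> \<open>Splits \<open>y\<close> into \<open>(y - 1) + 1\<close>: the first part becomes
    a \<open>tterm\<close>, the second restores the term \<open>k = 0\<close> as a
    \<open>dterm\<close>.\<close>
  have step: "a * (p * y) * (c * x) = c * (a * (p * (y - 1) * x + p * x))" for a p y c x :: complex
    by (simp add: algebra_simps)
  have "dterm q d A n0 i j (m * q + r + (q - 1) * n0) s =
      of_nat (q * n + r) powr (- s) * (A r * f n) $$ (i, j)"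
    unfolding dterm_def index using f_step[OF n assms(1)] by simp
  also have "(A r * f n) $$ (i, j) = (\<Sum>l<d. A r $$ (i, l) * f n $$ (l, j))"
    by (rule mat_mult_entry[OF A[OF assms(1)] f_carrier assms(2,3)])
  finally show ?thesis
    unfolding powr_digit_shift[OF n] tterm_def dterm_def n_def[symmetric] sum_distrib_left step .
qed

text \<open>The first \<open>(q - 1) * n0\<close> indices are the integers from \<open>n0\<close> to
  \<open>q * n0 - 1\<close>; their quotients by \<open>q\<close> fall below \<open>n0\<close>, so
  they stay behind as a finite sum. The rest is grouped into consecutive blocks of length
  \<open>q\<close>, one term per digit, without rearrangement.\<close>

lemma F_entry_functional_equation:
  assumes "i < d" "j < d" "\<rho> < real q powr (Re s - 1)"
  shows "F s $$ (i, j) = (\<Sum>n\<in>{n0..<q * n0}. of_nat n powr (- s) * (f n $$ (i, j))) +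
    (\<Sum>r<q. \<Sum>l<d. A r $$ (i, l) * (of_nat q powr (- s) *
      (binser q d A n0 r s $$ (l, j) + F s $$ (l, j))))"
proof -
  define N where "N = (q - 1) * n0"
  have s0: "\<rho> < real q powr Re s" using halfplane_mono[OF assms(3)] by simp
  have Fsums: "(\<lambda>k. dterm q d A n0 l j k s) sums (F s $$ (l, j))" if "l < d" for l
    unfolding F_entry[OF that assms(2)]
    by (rule summable_sums[OF summable_norm_cancel[OF dterm_summable[OF that assms(2,3)]]])
  have Tsums: "(\<lambda>k. tterm r l j k s) sums (binser q d A n0 r s $$ (l, j))" if "r < q" "l < d" for r l
    unfolding binser_eq_suminf(1)[OF that assms(2) s0]
    by (rule summable_sums[OF summable_norm_cancel[OF binser_eq_suminf(2)[OF that assms(2) s0]]])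
  have "(\<lambda>m. \<Sum>r<q. \<Sum>l<d. A r $$ (i, l) * (of_nat q powr (- s) *
      (tterm r l j m s + dterm q d A n0 l j m s))) sums
    (\<Sum>r<q. \<Sum>l<d. A r $$ (i, l) * (of_nat q powr (- s) *
      (binser q d A n0 r s $$ (l, j) + F s $$ (l, j))))"
    by (intro sums_sum sums_mult sums_add Tsums Fsums) auto
  moreover have "(\<Sum>r<q. \<Sum>l<d. A r $$ (i, l) * (of_nat q powr (- s) *
      (tterm r l j m s + dterm q d A n0 l j m s))) =
      (\<Sum>k\<in>{m * q..<m * q + q}. dterm q d A n0 i j (k + N) s)" for m
  proof -
    have "(\<Sum>k\<in>{m * q..<m * q + q}. dterm q d A n0 i j (k + N) s) =
        (\<Sum>r<q. dterm q d A n0 i j (m * q + r + N) s)"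
      by (subst sum.atLeastLessThan_shift_0) (simp add: lessThan_atLeast0)
    also have "\<dots> = (\<Sum>r<q. \<Sum>l<d. A r $$ (i, l) * (of_nat q powr (- s) *
      (tterm r l j m s + dterm q d A n0 l j m s)))"
      unfolding N_def by (intro sum.cong refl dterm_digit_shift assms) auto
    finally show ?thesis ..
  qed
  moreover have "(\<lambda>m. \<Sum>k\<in>{m * q..<m * q + q}. dterm q d A n0 i j (k + N) s) sums
      (F s $$ (i, j) - (\<Sum>k<N. dterm q d A n0 i j k s))"
    using q by (intro sums_group sums_split_initial_segment Fsums assms) auto
  ultimately have "F s $$ (i, j) - (\<Sum>k<N. dterm q d A n0 i j k s) =
    (\<Sum>r<q. \<Sum>l<d. A r $$ (i, l) * (of_nat q powr (- s) *
      (binser q d A n0 r s $$ (l, j) + F s $$ (l, j))))"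
    using sums_unique2 by (simp cong: sum.cong)
  moreover have "(\<Sum>k<N. dterm q d A n0 i j k s) =
      (\<Sum>n\<in>{n0..<q * n0}. of_nat n powr (- s) * (f n $$ (i, j)))"
  proof -
    have "N + n0 = q * n0" using q by (cases q) (auto simp: N_def)
    thus ?thesis
      using sum.shift_bounds_nat_ivl[of "\<lambda>n. of_nat n powr (- s) * (f n $$ (i, j))" 0 n0 N]
      by (simp add: dterm_def lessThan_atLeast0)
  qed
  ultimately show ?thesis by (simp add: algebra_simps)
qed

lemma G_entry:
  assumes "i < d" "j < d"
  shows "G s $$ (i, j) = (\<Sum>n\<in>{n0..<q * n0}. of_nat n powr (- s) * (f n $$ (i, j))) +
    of_nat q powr (- s) * (\<Sum>r<q. \<Sum>l<d. A r $$ (i, l) * binser q d A n0 r s $$ (l, j))"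
proof -
  have "(A r * binser q d A n0 r s) $$ (i, j) = (\<Sum>l<d. A r $$ (i, l) * binser q d A n0 r s $$ (l, j))"
    if "r < q" for r
    by (rule mat_mult_entry[OF A[OF that] binser_carrier assms])
  thus ?thesis using assms by (simp add: dirG_def)
qed

lemma C_carrier: "C \<in> carrier_mat d d"
  by (simp add: sumA_def)

lemma C_entry: "i < d \<Longrightarrow> j < d \<Longrightarrow> C $$ (i, j) = (\<Sum>r<q. A r $$ (i, j))"
  by (simp add: sumA_def)

lemma G_carrier: "G s \<in> carrier_mat d d"
  by (simp add: dirG_def)

lemma one_minus_smult_mult_entry:
  assumes "X \<in> carrier_mat d d" "i < d" "j < d"
  shows "((1\<^sub>m d - w \<cdot>\<^sub>m C) * X) $$ (i, j) = X $$ (i, j) - w * (\<Sum>l<d. C $$ (i, l) * X $$ (l, j))"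
proof -
  have "((1\<^sub>m d - w \<cdot>\<^sub>m C) * X) $$ (i, j) = (\<Sum>l<d. (1\<^sub>m d - w \<cdot>\<^sub>m C) $$ (i, l) * X $$ (l, j))"
    using C_carrier assms by (intro mat_mult_entry[of _ d]) auto
  also have "\<dots> = (\<Sum>l<d. (if i = l then X $$ (l, j) else 0) - w * (C $$ (i, l) * X $$ (l, j)))"
    using C_carrier assms by (intro sum.cong) (auto simp: algebra_simps)
  also have "\<dots> = X $$ (i, j) - w * (\<Sum>l<d. C $$ (i, l) * X $$ (l, j))"
    using assms by (simp add: sum_subtractf sum_distrib_left)
  finally show ?thesis .
qed

lemma functional_equation:
  assumes "\<rho> < real q powr (Re s - 1)"
  shows "(1\<^sub>m d - (of_nat q powr (- s)) \<cdot>\<^sub>m C) * F s = G s"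
proof (rule eq_matI)
  fix i j assume "i < dim_row (G s)" "j < dim_col (G s)"
  hence ij: "i < d" "j < d" using G_carrier[of s] by auto
  \<comment> \<open>Summing over the digits turns the contributions \<open>A r * F s\<close> into
    \<open>C * F s\<close>, the part that belongs on the left-hand side.\<close>
  have "(\<Sum>l<d. C $$ (i, l) * F s $$ (l, j)) = (\<Sum>r<q. \<Sum>l<d. A r $$ (i, l) * F s $$ (l, j))"
    using ij by (subst sum.swap) (simp add: C_entry sum_distrib_right)
  thus "((1\<^sub>m d - (of_nat q powr (- s)) \<cdot>\<^sub>m C) * F s) $$ (i, j) = G s $$ (i, j)"
    unfolding one_minus_smult_mult_entry[OF F_carrier ij] G_entry[OF ij]
    by (subst F_entry_functional_equation[OF ij assms])
      (simp add: sum_distrib_left distrib_left sum.distrib mult.left_commute)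
qed (use carrier_matD[OF C_carrier] carrier_matD[OF F_carrier] carrier_matD[OF G_carrier] in simp_all)

end

section \<open>The resolvent of a Jordan matrix\<close>

definition holomorphic_mat :: "nat \<Rightarrow> (complex \<Rightarrow> complex mat) \<Rightarrow> bool" where
  "holomorphic_mat n N \<longleftrightarrow> (\<forall>x. N x \<in> carrier_mat n n) \<and>
     (\<forall>i<n. \<forall>j<n. (\<lambda>x. N x $$ (i, j)) holomorphic_on UNIV)"

lemma holomorphic_mat_mult:
  assumes "holomorphic_mat n M" "holomorphic_mat n N"
  shows "holomorphic_mat n (\<lambda>x. M x * N x)"
  unfolding holomorphic_mat_def
proof (intro conjI allI impI)
  have M: "M x \<in> carrier_mat n n" and N: "N x \<in> carrier_mat n n" for x
    using assms by (auto simp: holomorphic_mat_def)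
  show "M x * N x \<in> carrier_mat n n" for x using M N by (rule mult_carrier_mat)
  fix i j assume "i < n" "j < n"
  thus "(\<lambda>x. (M x * N x) $$ (i, j)) holomorphic_on UNIV"
    unfolding mat_mult_entry[OF M N \<open>i < n\<close> \<open>j < n\<close>] using assms
    by (intro holomorphic_intros) (auto simp: holomorphic_mat_def)
qed

lemma holomorphic_mat_const: "P \<in> carrier_mat n n \<Longrightarrow> holomorphic_mat n (\<lambda>_. P)"
  by (auto simp: holomorphic_mat_def)

text \<open>With the spectrum and \<open>jordan_index\<close> as arguments this is the minimal
  polynomial of the matrix, evaluated at \<open>x\<close>.\<close>

definition polyval :: "complex set \<Rightarrow> (complex \<Rightarrow> nat) \<Rightarrow> complex \<Rightarrow> complex" where
  "polyval S m x = (\<Prod>b\<in>S. (x - b) ^ m b)"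

text \<open>Inverting the block by a geometric series in its nilpotent part puts
  \<open>1 / (x - a) ^ (j - i + 1)\<close> at each position on or above the diagonal. Multiplication
  by \<open>polyval S m x\<close> clears these denominators because
  \<open>j - i < n \<le> m a\<close>.\<close>

lemma jordan_block_adjugate:
  assumes "finite S" "a \<in> S" "n \<le> m a"
  obtains N where "holomorphic_mat n N"
    "\<And>x. (x \<cdot>\<^sub>m 1\<^sub>m n - jordan_block n a) * N x = polyval S m x \<cdot>\<^sub>m 1\<^sub>m n"
proof -
  define h where "h x = (\<Prod>b\<in>S - {a}. (x - b) ^ m b)" for x
  define N where "N x = mat n n (\<lambda>(i, j). if i \<le> j then (x - a) ^ (m a - Suc (j - i)) * h x else 0)" for x
  have p: "polyval S m x = (x - a) ^ m a * h x" for x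
    unfolding polyval_def h_def by (rule prod.remove[OF assms(1,2)])
  have N: "N x \<in> carrier_mat n n" for x by (simp add: N_def)
  have "holomorphic_mat n N"
    unfolding holomorphic_mat_def
  proof (intro conjI allI impI N)
    fix i j assume "i < n" "j < n"
    thus "(\<lambda>x. N x $$ (i, j)) holomorphic_on UNIV"
      by (cases "i \<le> j") (auto simp: N_def h_def intro!: holomorphic_intros)
  qed
  moreover have "(x \<cdot>\<^sub>m 1\<^sub>m n - jordan_block n a) * N x = polyval S m x \<cdot>\<^sub>m 1\<^sub>m n" for x
  proof (rule eq_matI)
    fix i j assume "i < dim_row (polyval S m x \<cdot>\<^sub>m 1\<^sub>m n)" "j < dim_col (polyval S m x \<cdot>\<^sub>m 1\<^sub>m n)"
    hence ij: "i < n" "j < n" by auto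
    have "((x \<cdot>\<^sub>m 1\<^sub>m n - jordan_block n a) * N x) $$ (i, j) =
        (\<Sum>k<n. (x \<cdot>\<^sub>m 1\<^sub>m n - jordan_block n a) $$ (i, k) * N x $$ (k, j))"
      by (rule mat_mult_entry[OF _ N ij]) (simp add: minus_carrier_mat)
    also have "\<dots> = (\<Sum>k<n. (if k = i then (x - a) * N x $$ (k, j) else 0) -
        (if k = Suc i then N x $$ (k, j) else 0))"
      using ij by (intro sum.cong) auto
    also have "\<dots> = (x - a) * N x $$ (i, j) - (if Suc i < n then N x $$ (Suc i, j) else 0)"
      using ij by (simp add: sum_subtractf)
    also have "\<dots> = (if i = j then polyval S m x else 0)"
    proof -
      consider "i > j" | "i = j" | "i < j" by linarith
      thus ?thesis
      proof cases
        case 1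
        thus ?thesis using ij by (simp add: N_def)
      next
        case 2
        have "m a = Suc (m a - 1)" using ij assms(3) by simp
        hence "(x - a) * (x - a) ^ (m a - 1) = (x - a) ^ m a" by (metis power_Suc)
        thus ?thesis using 2 ij by (simp add: N_def p)
      next
        \<comment> \<open>Above the diagonal the two terms cancel; \<open>j - i < m a\<close> keeps
          the truncated subtractions exact.\<close>
        case 3
        have "m a - (j - i) = Suc (m a - Suc (j - i))" using 3 ij assms(3) by simp
        moreover have "Suc (j - Suc i) = j - i" using 3 by simp
        ultimately have "(x - a) * (x - a) ^ (m a - Suc (j - i)) = (x - a) ^ (m a - Suc (j - Suc i))"
          by (metis power_Suc)
        thus ?thesis using 3 ij by (simp add: N_def)
      qed
    qed
    finally show "((x \<cdot>\<^sub>m 1\<^sub>m n - jordan_block n a) * N x) $$ (i, j) = (polyval S m x \<cdot>\<^sub>m 1\<^sub>m n) $$ (i, j)"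
      using ij by simp
  qed (auto simp: N_def)
  ultimately show thesis using that by blast
qed

text \<open>All blocks share the scalar \<open>polyval S m x\<close>, so their numerators can be put
  on the diagonal. This is why a single block may be smaller than \<open>m a\<close> and carries the
  factors of the other eigenvalues.\<close>

lemma jordan_matrix_adjugate:
  assumes "finite S" "\<And>k a. (k, a) \<in> set n_as \<Longrightarrow> a \<in> S \<and> k \<le> m a"
  shows "\<exists>N. holomorphic_mat (sum_list (map fst n_as)) N \<and>
    (\<forall>x. (x \<cdot>\<^sub>m 1\<^sub>m (sum_list (map fst n_as)) - jordan_matrix n_as) * N x =
      polyval S m x \<cdot>\<^sub>m 1\<^sub>m (sum_list (map fst n_as)))"
  using assms(2)
proof (induction n_as)
  case Nil
  show ?case by (intro exI[of _ "\<lambda>x. 1\<^sub>m 0"] conjI allI holomorphic_mat_const eq_matI) auto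
next
  case (Cons na n_as)
  obtain n a where na: "na = (n, a)" by force
  define n2 where "n2 = sum_list (map fst n_as)"
  obtain N1 where N1: "holomorphic_mat n N1"
    "\<And>x. (x \<cdot>\<^sub>m 1\<^sub>m n - jordan_block n a) * N1 x = polyval S m x \<cdot>\<^sub>m 1\<^sub>m n"
    using jordan_block_adjugate[OF assms(1), of a n m] Cons.prems[of n a] na by auto
  obtain N2 where N2: "holomorphic_mat n2 N2"
    "\<And>x. (x \<cdot>\<^sub>m 1\<^sub>m n2 - jordan_matrix n_as) * N2 x = polyval S m x \<cdot>\<^sub>m 1\<^sub>m n2"
    using Cons.IH Cons.prems unfolding n2_def by fastforce
  have c1: "N1 x \<in> carrier_mat n n" and c2: "N2 x \<in> carrier_mat n2 n2" for x
    using N1 N2 by (auto simp: holomorphic_mat_def)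
  have J2: "jordan_matrix n_as \<in> carrier_mat n2 n2" by (simp add: n2_def)
  define N where "N x = four_block_mat (N1 x) (0\<^sub>m n n2) (0\<^sub>m n2 n) (N2 x)" for x
  have "holomorphic_mat (n + n2) N"
    unfolding holomorphic_mat_def
  proof (intro conjI allI impI)
    show "N x \<in> carrier_mat (n + n2) (n + n2)" for x
      unfolding N_def by (rule four_block_carrier_mat[OF c1 c2])
    fix i j assume ij: "i < n + n2" "j < n + n2"
    have "N x $$ (i, j) = (if i < n then if j < n then N1 x $$ (i, j) else 0
        else if j < n then 0 else N2 x $$ (i - n, j - n))" for x
      using ij c1[of x] c2[of x] by (auto simp: N_def)
    thus "(\<lambda>x. N x $$ (i, j)) holomorphic_on UNIV"
      using ij N1(1) N2(1) by (cases "i < n"; cases "j < n") (auto simp: holomorphic_mat_def)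
  qed
  moreover have "(x \<cdot>\<^sub>m 1\<^sub>m (n + n2) - jordan_matrix (na # n_as)) * N x =
      polyval S m x \<cdot>\<^sub>m 1\<^sub>m (n + n2)" for x
  proof -
    have "x \<cdot>\<^sub>m 1\<^sub>m (n + n2) - jordan_matrix (na # n_as) =
      four_block_mat (x \<cdot>\<^sub>m 1\<^sub>m n - jordan_block n a) (0\<^sub>m n n2) (0\<^sub>m n2 n)
        (x \<cdot>\<^sub>m 1\<^sub>m n2 - jordan_matrix n_as)"
      unfolding na jordan_matrix_Cons n2_def[symmetric]
      using J2 by (intro eq_matI) (auto simp: n2_def)
    also have "\<dots> * N x = four_block_mat (polyval S m x \<cdot>\<^sub>m 1\<^sub>m n) (0\<^sub>m n n2) (0\<^sub>m n2 n)
        (polyval S m x \<cdot>\<^sub>m 1\<^sub>m n2)"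
      unfolding N_def using J2 c1[of x] c2[of x]
      by (subst mult_four_block_mat[of _ n n _ n2 _ n2 _ _ n _ n2])
        (auto simp: N1(2) N2(2) minus_carrier_mat)
    also have "\<dots> = polyval S m x \<cdot>\<^sub>m 1\<^sub>m (n + n2)"
      by (intro eq_matI) auto
    finally show ?thesis .
  qed
  ultimately show ?case by (auto simp: na n2_def)
qed

text \<open>The maximum in \<open>jordan_index\<close> is informative only over a finite set;
  finiteness holds because every block size is at most the algebraic multiplicity, hence at most
  \<open>n\<close>.\<close>

lemma jordan_nf_size_le_index:
  assumes "C \<in> carrier_mat n n" "jordan_nf C n_as" "(k, a) \<in> set n_as"
  shows "k \<le> jordan_index C a" "a \<in> spectrum C"
proof -
  have le: "k' \<le> n" if "jordan_nf C n_as'" "(k', a) \<in> set n_as'" for k' n_as'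
  proof -
    have "k' \<le> order a (char_poly C)" by (rule jordan_nf_block_size_order_bound[OF that])
    also have "\<dots> \<le> degree (char_poly C)"
      using degree_monic_char_poly[OF assms(1)] by (intro order_degree) auto
    finally show ?thesis using degree_monic_char_poly[OF assms(1)] by simp
  qed
  hence "{k. \<exists>n_as. jordan_nf C n_as \<and> (k, a) \<in> set n_as} \<subseteq> {..n}" by blast
  hence "finite {k. \<exists>n_as. jordan_nf C n_as \<and> (k, a) \<in> set n_as}"
    by (rule finite_subset) simp
  thus "k \<le> jordan_index C a"
    unfolding jordan_index_def using assms by (intro Max_ge) blast+
  have "k \<noteq> 0" using assms(2,3) by (force simp: jordan_nf_def)
  hence "order a (char_poly C) \<noteq> 0"
    using jordan_nf_block_size_order_bound[OF assms(2,3)] by simp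
  thus "a \<in> spectrum C" using spectrum_root_char_poly[OF assms(1)] order_root by blast
qed

text \<open>Plays the role of the adjugate, but with the minimal polynomial in place of the
  characteristic one, so that the pole orders of the resolvent come out sharp.\<close>
lemma resolvent_numerator:
  fixes C :: "complex mat"
  assumes C: "C \<in> carrier_mat n n"
  obtains N where "holomorphic_mat n N"
    "\<And>x. (x \<cdot>\<^sub>m 1\<^sub>m n - C) * N x = polyval (spectrum C) (jordan_index C) x \<cdot>\<^sub>m 1\<^sub>m n"
proof -
  let ?p = "polyval (spectrum C) (jordan_index C)"
  obtain n_as where jnf: "jordan_nf C n_as"
    using char_poly_factorized[OF C] jordan_nf_exists[OF C] by blast
  let ?J = "jordan_matrix n_as"
  obtain P Q where wit: "similar_mat_wit C ?J P Q"
    using jnf unfolding jordan_nf_def similar_mat_def by blast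
  note PQ = similar_mat_witD[OF _ wit, of n]
  have dim: "n = dim_row C" using C by simp
  note PQ = PQ[OF dim]
  have n: "sum_list (map fst n_as) = n" using carrier_matD(1)[OF PQ(5)] by simp
  obtain N where N: "holomorphic_mat n N"
    "\<And>x. (x \<cdot>\<^sub>m 1\<^sub>m n - ?J) * N x = ?p x \<cdot>\<^sub>m 1\<^sub>m n"
    using jordan_matrix_adjugate[OF card_finite_spectrum(1)[OF C], of n_as "jordan_index C"]
      jordan_nf_size_le_index[OF C jnf] unfolding n by blast
  have Nc: "N x \<in> carrier_mat n n" for x using N by (simp add: holomorphic_mat_def)
  have "holomorphic_mat n (\<lambda>x. P * N x * Q)"
    using N PQ by (intro holomorphic_mat_mult holomorphic_mat_const)
  moreover have "(x \<cdot>\<^sub>m 1\<^sub>m n - C) * (P * N x * Q) = ?p x \<cdot>\<^sub>m 1\<^sub>m n" for x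
  proof -
    let ?X = "x \<cdot>\<^sub>m 1\<^sub>m n - ?J"
    have X: "?X \<in> carrier_mat n n" using PQ(5) by (simp add: minus_carrier_mat)
    \<comment> \<open>\<open>P\<close> intertwines the two shifted matrices, which brings the Jordan
      factor next to \<open>N x\<close>.\<close>
    have "(x \<cdot>\<^sub>m 1\<^sub>m n - C) * P = P * ?X"
    proof -
      have "C * P = P * ?J * (Q * P)"
        using PQ(5-7) by (subst PQ(3)) (simp add: assoc_mult_mat[of _ n n _ n _ n])
      also have "\<dots> = P * ?J"
        unfolding PQ(2) by (rule right_mult_one_mat[OF mult_carrier_mat[OF PQ(6) PQ(5)]])
      finally have "C * P = P * ?J" .
      have xI: "x \<cdot>\<^sub>m 1\<^sub>m n \<in> carrier_mat n n" by simp
      have "(x \<cdot>\<^sub>m 1\<^sub>m n - C) * P = x \<cdot>\<^sub>m 1\<^sub>m n * P - C * P"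
        by (rule minus_mult_distrib_mat[OF xI PQ(4,6)])
      also have "x \<cdot>\<^sub>m 1\<^sub>m n * P = P * (x \<cdot>\<^sub>m 1\<^sub>m n)"
        using PQ(6) mult_smult_distrib[OF PQ(6) one_carrier_mat, of x]
          mult_smult_assoc_mat[OF one_carrier_mat PQ(6), of x] by simp
      also have "P * (x \<cdot>\<^sub>m 1\<^sub>m n) - C * P = P * ?X"
        unfolding \<open>C * P = P * ?J\<close> by (rule mult_minus_distrib_mat[OF PQ(6) xI PQ(5), symmetric])
      finally show ?thesis .
    qed
    moreover have M: "x \<cdot>\<^sub>m 1\<^sub>m n - C \<in> carrier_mat n n" using PQ(4) by (simp add: minus_carrier_mat)
    ultimately have "(x \<cdot>\<^sub>m 1\<^sub>m n - C) * (P * N x * Q) = P * (?X * N x) * Q"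
      by (simp only: assoc_mult_mat[OF M mult_carrier_mat[OF PQ(6) Nc] PQ(7), symmetric]
          assoc_mult_mat[OF M PQ(6) Nc, symmetric] assoc_mult_mat[OF PQ(6) X Nc])
    also have "\<dots> = ?p x \<cdot>\<^sub>m (P * Q)"
      unfolding N(2) mult_smult_distrib[OF PQ(6) one_carrier_mat] right_mult_one_mat[OF PQ(6)]
      by (rule mult_smult_assoc_mat[OF PQ(6,7)])
    finally show ?thesis unfolding PQ(1) .
  qed
  ultimately show thesis using that by blast
qed

section \<open>Growth of the right-hand side in vertical strips\<close>

text \<open>Mean value inequality on the segment from 1 to \<open>1 + x\<close>: it lies in the real
  interval from 1 to 2, where the derivative of the power has norm at most
  \<open>2 powr (\<bar>Re s\<bar> + 1) * norm s\<close>.\<close>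

lemma norm_one_plus_powr_minus_one_le:
  fixes s :: complex and x :: real
  assumes x: "0 \<le> x" "x \<le> 1"
  shows "norm ((1 + of_real x) powr (- s) - 1) \<le> 2 powr (\<bar>Re s\<bar> + 1) * (norm s * x)"
proof -
  define S where "S = closed_segment 1 (1 + of_real x :: complex)"
  have S: "\<exists>t. z = of_real t \<and> 1 \<le> t \<and> t \<le> 2" if z: "z \<in> S" for z
  proof -
    obtain u where u: "0 \<le> u" "u \<le> 1" "z = (1 - u) *\<^sub>R 1 + u *\<^sub>R (1 + of_real x)"
      using z unfolding S_def in_segment by blast
    have "z = of_real (1 + u * x)" unfolding u(3) by (simp add: scaleR_conv_of_real algebra_simps)
    moreover have "u * x \<le> 1" using u x by (simp add: mult_le_one)
    ultimately show ?thesis using u x by (intro exI[of _ "1 + u * x"]) auto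
  qed
  have "norm ((1 + of_real x) powr (- s) - 1 powr (- s)) \<le>
      (2 powr (\<bar>Re s\<bar> + 1) * norm s) * norm ((1 + of_real x) - 1 :: complex)"
  proof (rule field_differentiable_bound[of S])
    show "convex S" by (simp add: S_def)
    show "1 + of_real x \<in> S" "1 \<in> S" by (simp_all add: S_def)
    fix z assume "z \<in> S"
    then obtain t where t: "z = of_real t" "1 \<le> t" "t \<le> 2" using S by blast
    have "z \<notin> \<real>\<^sub>\<le>\<^sub>0" using t by simp
    thus "((\<lambda>z. z powr (- s)) has_field_derivative (- s * z powr (- s - 1))) (at z within S)"
      by (rule has_field_derivative_at_within[OF has_field_derivative_powr])
    have "norm (z powr (- s - 1)) = t powr (- Re s - 1)"
      using t by (simp add: norm_powr_real_powr)
    also have "\<dots> \<le> t powr (\<bar>Re s\<bar> + 1)" using t by (intro powr_mono) auto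
    also have "\<dots> \<le> 2 powr (\<bar>Re s\<bar> + 1)" using t by (intro powr_mono2) auto
    finally show "norm (- s * z powr (- s - 1)) \<le> 2 powr (\<bar>Re s\<bar> + 1) * norm s"
      by (simp add: norm_mult mult.commute mult_left_mono)
  qed
  thus ?thesis using x by (simp add: mult_ac)
qed

text \<open>Interpolates between the linear bound of the mean value theorem and the trivial bound.\<close>
lemma norm_one_plus_powr_minus_one_interpolation:
  fixes s :: complex and x \<theta> :: real
  assumes x: "0 \<le> x" "x \<le> 1" and \<theta>: "0 \<le> \<theta>" "\<theta> \<le> 1"
  shows "norm ((1 + of_real x) powr (- s) - 1) \<le> 2 powr (\<bar>Re s\<bar> + 1) * (norm s * x) powr \<theta>"
proof (cases "norm s * x \<le> 1")
  case True
  \<comment> \<open>The value 0 is split off: \<open>0 powr \<theta>\<close> is 0 even for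
    \<open>\<theta> = 0\<close>.\<close>
  have "norm s * x \<le> (norm s * x) powr \<theta>"
  proof (cases "norm s * x = 0")
    case False
    have "0 \<le> norm s * x" using x by simp
    hence "0 < norm s * x" using False by linarith
    thus ?thesis using powr_mono'[OF \<theta>(2), of "norm s * x"] True by simp
  next
    case True
    show ?thesis unfolding True by simp
  qed
  hence "2 powr (\<bar>Re s\<bar> + 1) * (norm s * x) \<le> 2 powr (\<bar>Re s\<bar> + 1) * (norm s * x) powr \<theta>"
    by (intro mult_left_mono) auto
  thus ?thesis using norm_one_plus_powr_minus_one_le[OF x, of s] by linarith
next
  case False
  have "norm ((1 + of_real x) powr (- s)) = norm ((of_real (1 + x) :: complex) powr (- s))" by simp
  also have "\<dots> = (1 + x) powr (- Re s)"
    using x by (subst norm_powr_real_powr) auto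
  also have "\<dots> \<le> (1 + x) powr \<bar>Re s\<bar>" using x by (intro powr_mono) auto
  also have "\<dots> \<le> 2 powr \<bar>Re s\<bar>" using x by (intro powr_mono2) auto
  finally have "norm ((1 + of_real x) powr (- s) - 1) \<le> 2 powr \<bar>Re s\<bar> + 1"
    using norm_triangle_ineq4[of "(1 + of_real x) powr (- s)" 1] by simp
  also have "\<dots> \<le> 2 powr (\<bar>Re s\<bar> + 1)"
    using ge_one_powr_ge_zero[of 2 "\<bar>Re s\<bar>"] by (simp add: powr_add)
  also have "\<dots> \<le> 2 powr (\<bar>Re s\<bar> + 1) * (norm s * x) powr \<theta>"
    using ge_one_powr_ge_zero[of "norm s * x" \<theta>] False \<theta> by simp
  finally show ?thesis .
qed

text \<open>Matrix powers multiply on the right, whereas words grow by a letter on the left.\<close>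

lemma pow_mat_Suc_left:
  assumes M: "M \<in> carrier_mat n n"
  shows "M ^\<^sub>m Suc l = M * M ^\<^sub>m l"
proof (induction l)
  case (Suc l)
  have "M ^\<^sub>m Suc (Suc l) = M * M ^\<^sub>m l * M" using Suc by simp
  also have "\<dots> = M * (M ^\<^sub>m l * M)" by (rule assoc_mult_mat[OF M pow_carrier_mat[OF M] M])
  finally show ?case by simp
qed (use M in simp)

context regular_matrix_sequence
begin

text \<open>The increment contributes an extra \<open>n powr (- \<theta>)\<close> at the price of
  \<open>norm s powr \<theta>\<close>, which moves the abscissa of the majorant from
  \<open>Re s\<close> to \<open>Re s + \<theta>\<close>.\<close>

lemma norm_tterm_le:
  assumes "r < q" "i < d" "j < d" "0 \<le> \<theta>" "\<theta> \<le> 1"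
  shows "norm (tterm r i j m s) \<le> 2 powr (\<bar>Re s\<bar> + 1) * norm s powr \<theta> *
    (real (m + n0) powr (- (Re s + \<theta>)) * fnorm (f (m + n0)))"
proof -
  define n where "n = m + n0"
  have n: "0 < n" using n0 by (simp add: n_def)
  define x where "x = real r / (real q * real n)"
  have "real r / real q \<le> 1" using assms(1) q by simp
  hence "real r / real q / real n \<le> 1 / real n" by (intro divide_right_mono) auto
  hence xn: "0 \<le> x" "x \<le> 1 / real n" by (simp_all add: x_def)
  have "1 / real n \<le> 1" using n by simp
  hence x1: "x \<le> 1" using xn by linarith
  have "norm ((1 + of_real x) powr (- s) - 1) \<le> 2 powr (\<bar>Re s\<bar> + 1) * (norm s * x) powr \<theta>"
    by (rule norm_one_plus_powr_minus_one_interpolation[OF xn(1) x1 assms(4,5)])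
  also have "(norm s * x) powr \<theta> \<le> (norm s * (1 / real n)) powr \<theta>"
    using xn assms(4) by (intro powr_mono2 mult_left_mono) auto
  also have "(norm s * (1 / real n)) powr \<theta> = norm s powr \<theta> * real n powr (- \<theta>)"
    by (simp add: powr_divide powr_minus_divide)
  finally have incr: "norm ((1 + of_real x) powr (- s) - 1) \<le>
      2 powr (\<bar>Re s\<bar> + 1) * (norm s powr \<theta> * real n powr (- \<theta>))" by simp
  have "norm (tterm r i j m s) =
      real n powr (- Re s) * norm ((1 + of_real x) powr (- s) - 1) * norm (f n $$ (i, j))"
    unfolding tterm_def n_def[symmetric] norm_mult norm_of_nat_powr by (simp add: x_def)
  also have "\<dots> \<le> real n powr (- Re s) *
      (2 powr (\<bar>Re s\<bar> + 1) * (norm s powr \<theta> * real n powr (- \<theta>))) * fnorm (f n)"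
    using assms by (intro mult_mono incr norm_f_entry mult_nonneg_nonneg) auto
  also have "\<dots> = 2 powr (\<bar>Re s\<bar> + 1) * norm s powr \<theta> *
      ((real n powr (- Re s) * real n powr (- \<theta>)) * fnorm (f n))" by (simp only: mult_ac)
  also have "real n powr (- Re s) * real n powr (- \<theta>) = real n powr (- (Re s + \<theta>))"
    by (simp add: powr_add[symmetric])
  finally show ?thesis by (simp only: n_def)
qed

lemma norm_binser_le:
  assumes "r < q" "i < d" "j < d" "0 \<le> \<theta>" "\<theta> \<le> 1"
    and "\<rho> < real q powr Re s" "\<rho> < real q powr (Re s + \<theta> - 1)"
  shows "norm (binser q d A n0 r s $$ (i, j)) \<le>
    2 powr (\<bar>Re s\<bar> + 1) * norm s powr \<theta> * Fbound (Re s + \<theta>)"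
proof -
  note T = binser_eq_suminf[OF assms(1-3,6)]
  have "norm (binser q d A n0 r s $$ (i, j)) \<le> (\<Sum>m. norm (tterm r i j m s))"
    unfolding T(1) by (rule summable_norm[OF T(2)])
  also have "\<dots> \<le> (\<Sum>m. 2 powr (\<bar>Re s\<bar> + 1) * norm s powr \<theta> *
      (real (m + n0) powr (- (Re s + \<theta>)) * fnorm (f (m + n0))))"
    by (rule suminf_le[OF norm_tterm_le[OF assms(1-5)] T(2) summable_mult[OF summable_fnorm[OF assms(7)]]])
  also have "\<dots> = 2 powr (\<bar>Re s\<bar> + 1) * norm s powr \<theta> * Fbound (Re s + \<theta>)"
    unfolding Fbound_def by (rule suminf_mult[OF summable_fnorm[OF assms(7)]])
  finally show ?thesis .
qed

lemma norm_A_entry: "r < q \<Longrightarrow> i < d \<Longrightarrow> j < d \<Longrightarrow> norm (A r $$ (i, j)) \<le> fnorm (A r)"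
  using A[of r] by (intro norm_entry_le_fnorm) auto

lemma Fbound_nonneg:
  assumes "\<rho> < real q powr (\<sigma> - 1)"
  shows "0 \<le> Fbound \<sigma>"
  unfolding Fbound_def by (rule suminf_nonneg[OF summable_fnorm[OF assms]]) auto

lemma G_growth:
  assumes a: "\<rho> < real q powr a"
  obtains M where "0 \<le> M" "\<And>s i j. i < d \<Longrightarrow> j < d \<Longrightarrow> a \<le> Re s \<Longrightarrow> Re s \<le> a + 1 \<Longrightarrow> 1 \<le> \<bar>Im s\<bar> \<Longrightarrow>
    norm (G s $$ (i, j)) \<le> M * \<bar>Im s\<bar> powr (1 - (Re s - a))"
proof -
  \<comment> \<open>Bounds \<open>\<bar>Re s\<bar>\<close> throughout the strip; together with
    \<open>1 \<le> \<bar>Im s\<bar>\<close> it gives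
    \<open>norm s \<le> (1 + B) * \<bar>Im s\<bar>\<close>.\<close>
  define B where "B = \<bar>a\<bar> + 1"
  define K where "K = 2 powr (B + 1) * (1 + B) * Fbound (a + 1)"
  define M1 where "M1 = (\<Sum>n\<in>{n0..<q * n0}. real n powr (- a) * fnorm (f n))"
  define M2 where "M2 = real q powr (- a) * (\<Sum>r<q. \<Sum>l<d. fnorm (A r) * K)"
  have F0: "0 \<le> Fbound (a + 1)" using a by (intro Fbound_nonneg) simp
  have K0: "0 \<le> K" unfolding K_def B_def using F0 by (intro mult_nonneg_nonneg) auto
  have M1_0: "0 \<le> M1" unfolding M1_def by (intro sum_nonneg) auto
  have M2_0: "0 \<le> M2" unfolding M2_def using K0 by (intro mult_nonneg_nonneg sum_nonneg) auto
  have "norm (G s $$ (i, j)) \<le> (M1 + M2) * \<bar>Im s\<bar> powr (1 - (Re s - a))"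
    if ij: "i < d" "j < d" and s: "a \<le> Re s" "Re s \<le> a + 1" "1 \<le> \<bar>Im s\<bar>" for s i j
  proof -
    \<comment> \<open>Chosen so that \<open>Re s + \<theta> = a + 1\<close> for every
      \<open>s\<close> in the strip: the single constant \<open>Fbound (a + 1)\<close> then serves
      all of them.\<close>
    define \<theta> where "\<theta> = 1 - (Re s - a)"
    define Y where "Y = \<bar>Im s\<bar> powr \<theta>"
    have \<theta>: "0 \<le> \<theta>" "\<theta> \<le> 1" "Re s + \<theta> = a + 1" using s by (auto simp: \<theta>_def)
    have Y: "1 \<le> Y" unfolding Y_def using s \<theta> by (intro ge_one_powr_ge_zero) auto
    have B: "\<bar>Re s\<bar> \<le> B" "1 \<le> 1 + B" using s by (auto simp: B_def)
    have "norm s \<le> \<bar>Re s\<bar> + \<bar>Im s\<bar>" by (rule cmod_le)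
    also have "\<dots> \<le> B * \<bar>Im s\<bar> + \<bar>Im s\<bar>"
      using B s(3) mult_mono[of B B 1 "\<bar>Im s\<bar>"] by (intro add_mono) auto
    finally have "norm s \<le> (1 + B) * \<bar>Im s\<bar>" by (simp add: algebra_simps)
    hence "norm s powr \<theta> \<le> ((1 + B) * \<bar>Im s\<bar>) powr \<theta>" using \<theta> by (intro powr_mono2) auto
    also have "\<dots> = (1 + B) powr \<theta> * Y" by (simp add: powr_mult Y_def)
    also have "\<dots> \<le> (1 + B) * Y"
      using powr_mono[OF \<theta>(2) B(2)] B Y by (intro mult_right_mono) auto
    finally have s\<theta>: "norm s powr \<theta> \<le> (1 + B) * Y" .
    have bin: "norm (binser q d A n0 r s $$ (l, j)) \<le> K * Y" if "r < q" "l < d" for r l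
    proof -
      have "norm (binser q d A n0 r s $$ (l, j)) \<le> 2 powr (\<bar>Re s\<bar> + 1) * norm s powr \<theta> * Fbound (Re s + \<theta>)"
        using a halfplane_mono[OF a s(1)] \<theta>
        by (intro norm_binser_le that ij) auto
      also have "\<dots> \<le> 2 powr (B + 1) * ((1 + B) * Y) * Fbound (a + 1)"
        unfolding \<theta>(3) using B F0 s\<theta> Y by (intro mult_mono powr_mono mult_nonneg_nonneg) auto
      finally show ?thesis by (simp add: K_def mult_ac)
    qed
    have "norm (\<Sum>n\<in>{n0..<q * n0}. of_nat n powr (- s) * (f n $$ (i, j))) \<le> M1"
      unfolding M1_def
    proof (rule sum_norm_le)
      fix n assume "n \<in> {n0..<q * n0}"
      hence n: "1 \<le> n" using n0 by auto
      have "real n powr (- Re s) \<le> real n powr (- a)" using n s by (intro powr_mono) auto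
      thus "norm (of_nat n powr (- s) * (f n $$ (i, j))) \<le> real n powr (- a) * fnorm (f n)"
        unfolding norm_mult norm_of_nat_powr by (intro mult_mono norm_f_entry ij) auto
    qed
    also have "M1 \<le> M1 * Y" using Y M1_0 mult_left_mono[of 1 Y M1] by simp
    finally have 1: "norm (\<Sum>n\<in>{n0..<q * n0}. of_nat n powr (- s) * (f n $$ (i, j))) \<le> M1 * Y" .
    have "norm (\<Sum>r<q. \<Sum>l<d. A r $$ (i, l) * binser q d A n0 r s $$ (l, j)) \<le>
        (\<Sum>r<q. \<Sum>l<d. fnorm (A r) * (K * Y))"
    proof (intro sum_norm_le)
      fix r l assume "r \<in> {..<q}" "l \<in> {..<d}"
      thus "norm (A r $$ (i, l) * binser q d A n0 r s $$ (l, j)) \<le> fnorm (A r) * (K * Y)"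
        unfolding norm_mult using ij by (intro mult_mono norm_A_entry bin) auto
    qed
    moreover have "norm ((of_nat q :: complex) powr (- s)) \<le> real q powr (- a)"
      unfolding norm_of_nat_powr using q s by (intro powr_mono) auto
    ultimately have "norm (of_nat q powr (- s) *
        (\<Sum>r<q. \<Sum>l<d. A r $$ (i, l) * binser q d A n0 r s $$ (l, j))) \<le>
        real q powr (- a) * (\<Sum>r<q. \<Sum>l<d. fnorm (A r) * (K * Y))"
      unfolding norm_mult by (intro mult_mono) auto
    also have "\<dots> = M2 * Y" by (simp add: M2_def sum_distrib_right mult.assoc)
    finally have 2: "norm (of_nat q powr (- s) *
        (\<Sum>r<q. \<Sum>l<d. A r $$ (i, l) * binser q d A n0 r s $$ (l, j))) \<le> M2 * Y" .
    have "norm (G s $$ (i, j)) \<le> M1 * Y + M2 * Y"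
      unfolding G_entry[OF ij] by (rule order_trans[OF norm_triangle_ineq add_mono[OF 1 2]])
    thus ?thesis by (simp add: Y_def \<theta>_def distrib_right)
  qed
  thus thesis using that[of "M1 + M2"] M1_0 M2_0 by simp
qed

lemma G_holomorphic:
  assumes "i < d" "j < d"
  shows "(\<lambda>s. G s $$ (i, j)) holomorphic_on {s. \<rho> < real q powr Re s}"
  unfolding G_entry[OF assms] using assms q n0
  by (intro holomorphic_intros const_powr_uminus_holomorphic binser_holomorphic) auto

section \<open>The spectrum of \<open>C\<close> compared with the joint spectral radius\<close>

lemma C_power_entry:
  assumes "i < d" "j < d"
  shows "(C ^\<^sub>m l) $$ (i, j) = (\<Sum>rs\<in>words l. mprod d A rs $$ (i, j))"
  using assms
proof (induction l arbitrary: i)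
  case 0
  have "words 0 = {[]}" by (auto simp: words_def)
  thus ?case using C_carrier by simp
next
  case (Suc l)
  have "C ^\<^sub>m Suc l = C * C ^\<^sub>m l"
    by (rule pow_mat_Suc_left[OF C_carrier])
  hence "(C ^\<^sub>m Suc l) $$ (i, j) = (\<Sum>k<d. C $$ (i, k) * (C ^\<^sub>m l) $$ (k, j))"
    using mat_mult_entry[OF C_carrier pow_carrier_mat[OF C_carrier] Suc.prems] by simp
  also have "\<dots> = (\<Sum>k<d. \<Sum>r<q. \<Sum>rs\<in>words l. A r $$ (i, k) * mprod d A rs $$ (k, j))"
    using Suc by (intro sum.cong refl) (simp add: C_entry sum_product)
  also have "\<dots> = (\<Sum>r<q. \<Sum>rs\<in>words l. \<Sum>k<d. A r $$ (i, k) * mprod d A rs $$ (k, j))"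
    by (subst sum.swap, intro sum.cong refl, rule sum.swap)
  also have "\<dots> = (\<Sum>r<q. \<Sum>rs\<in>words l. mprod d A (r # rs) $$ (i, j))"
    unfolding mprod_Cons
    by (intro sum.cong refl, rule mat_mult_entry[symmetric, OF A mprod_carrier Suc.prems])
      (auto simp: words_def)
  also have "\<dots> = (\<Sum>rs\<in>words (Suc l). mprod d A rs $$ (i, j))"
    unfolding words_Suc by (subst sum.reindex) (auto simp: inj_on_def sum.cartesian_product case_prod_beta)
  finally show ?case .
qed

text \<open>An entry of the l-th power of \<open>C\<close> is a sum over \<open>q ^ l\<close> words,
  hence of order \<open>(q * R) ^ l\<close> for each \<open>R > \<rho>\<close>; an eigenvector
  transfers this rate to \<open>lam\<close>. For \<open>\<rho> = 0\<close> it leaves 0 as the only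
  possible eigenvalue.\<close>

lemma spectrum_le_jsr:
  assumes "lam \<in> spectrum C"
  shows "norm lam \<le> real q * \<rho>"
proof (rule ccontr)
  assume "\<not> norm lam \<le> real q * \<rho>"
  hence "\<rho> < norm lam / real q" using q by (simp add: field_simps)
  then obtain R where R: "\<rho> < R" "R < norm lam / real q" using dense by blast
  have R0: "0 < R" using R(1) jsr_nonneg by linarith
  have qR: "real q * R < norm lam" using R(2) q by (simp add: field_simps)
  obtain c where c: "0 < c" "\<And>rs. set rs \<subseteq> {..<q} \<Longrightarrow> fnorm (mprod d A rs) \<le> c * R ^ length rs"
    using fnorm_mprod_bound[OF R(1)] by blast
  have pow: "norm ((C ^\<^sub>m l) $$ (i, j)) \<le> c * (real q * R) ^ l" if ij: "i < d" "j < d" for i j l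
  proof -
    have "norm ((C ^\<^sub>m l) $$ (i, j)) \<le> (\<Sum>rs\<in>words l. c * R ^ l)"
      unfolding C_power_entry[OF ij]
    proof (rule sum_norm_le)
      fix rs assume "rs \<in> words l"
      hence rs: "set rs \<subseteq> {..<q}" "length rs = l" by (auto simp: words_def)
      show "norm (mprod d A rs $$ (i, j)) \<le> c * R ^ l"
        using c(2)[OF rs(1)] norm_entry_le_fnorm[of i "mprod d A rs" j] mprod_carrier[OF rs(1)] ij rs(2)
        by auto
    qed
    also have "\<dots> = c * (real q * R) ^ l" by (simp add: card_words power_mult_distrib)
    finally show ?thesis .
  qed
  obtain v where v: "eigenvector C v lam" using assms unfolding spectrum_def eigenvalue_def by auto
  have vc: "v \<in> carrier_vec d" "v \<noteq> 0\<^sub>v d" using v C_carrier by (auto simp: eigenvector_def)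
  then obtain i where i: "i < d" "v $ i \<noteq> 0" by (metis carrier_vecD eq_vecI index_zero_vec(1,2))
  define V where "V = (\<Sum>k<d. norm (v $ k))"
  have "norm lam ^ l * norm (v $ i) \<le> c * V * (real q * R) ^ l" for l
  proof -
    have "lam ^ l * v $ i = (C ^\<^sub>m l *\<^sub>v v) $ i"
      unfolding eigenvector_pow[OF C_carrier v] using i vc by simp
    also have "\<dots> = (\<Sum>k<d. (C ^\<^sub>m l) $$ (i, k) * v $ k)"
      using i vc carrier_matD[OF pow_carrier_mat[OF C_carrier, of l]] by (simp add: scalar_prod_def lessThan_atLeast0)
    finally have "norm (lam ^ l * v $ i) = norm (\<Sum>k<d. (C ^\<^sub>m l) $$ (i, k) * v $ k)" by simp
    also have "\<dots> \<le> (\<Sum>k<d. c * (real q * R) ^ l * norm (v $ k))"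
      by (intro sum_norm_le) (auto simp: norm_mult intro!: mult_right_mono pow i)
    also have "\<dots> = c * V * (real q * R) ^ l" by (simp add: V_def sum_distrib_left mult_ac)
    finally show ?thesis by (simp add: norm_mult norm_power)
  qed
  moreover have lam0: "0 < norm lam" using qR R0 q by (smt (verit) mult_nonneg_nonneg of_nat_0_le_iff)
  moreover have "\<bar>real q * R / norm lam\<bar> < 1" using qR R0 lam0 by (simp add: abs_mult)
  hence "(\<lambda>l. c * V * (real q * R / norm lam) ^ l) \<longlonglongrightarrow> c * V * 0"
    by (intro tendsto_mult tendsto_const LIMSEQ_power_zero) simp
  ultimately have "norm (v $ i) \<le> c * V * 0"
    by (intro LIMSEQ_le_const) (auto simp: power_divide field_simps)
  thus False using i(2) by simp
qed

end

section \<open>Meromorphic continuation\<close>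

locale regular_matrix_resolvent = regular_matrix_sequence +
  fixes N :: "complex \<Rightarrow> complex mat"
  assumes N_holomorphic: "holomorphic_mat d N"
    and N_resolvent: "\<And>x. (x \<cdot>\<^sub>m 1\<^sub>m d - sumA q d A) * N x =
      polyval (spectrum (sumA q d A)) (jordan_index (sumA q d A)) x \<cdot>\<^sub>m 1\<^sub>m d"
begin

abbreviation "qpow s \<equiv> (of_nat q :: complex) powr s"

definition p :: "complex \<Rightarrow> complex" where
  "p = polyval (spectrum C) (jordan_index C)"

text \<open>Multiplied by \<open>qpow s\<close>, the functional equation reads (q^s I - C) X = q^s
  G, and \<open>N x\<close> divided by \<open>p x\<close> inverts x I - C. Where
  \<open>p (qpow s)\<close> vanishes, division by zero yields the zero matrix.\<close>

definition \<Psi> :: "complex \<Rightarrow> complex mat" where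
  "\<Psi> s = (qpow s / p (qpow s)) \<cdot>\<^sub>m (N (qpow s) * G s)"

text \<open>The case split makes agreement with \<open>F\<close> on the half-plane of convergence
  immediate; wherever \<open>p (qpow s)\<close> is nonzero both branches coincide with
  \<open>\<Psi>\<close>.\<close>

definition \<Phi> :: "complex \<Rightarrow> complex mat" where
  "\<Phi> s = (if \<rho> < real q powr (Re s - 1) then F s else \<Psi> s)"

lemma N_carrier: "N x \<in> carrier_mat d d"
  using N_holomorphic by (simp add: holomorphic_mat_def)

lemma finite_spectrum: "finite (spectrum C)"
  by (rule card_finite_spectrum(1)[OF C_carrier])

lemma p_nonzero: "x \<notin> spectrum C \<Longrightarrow> p x \<noteq> 0"
  using finite_spectrum by (auto simp: p_def polyval_def)

lemma p_holomorphic: "p holomorphic_on X"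
  unfolding p_def polyval_def by (intro holomorphic_intros)

lemma qpow_exp: "qpow s = exp (s * of_real (ln (real q)))"
proof -
  have "Ln (of_nat q) = of_real (ln (real q))"
    using Ln_of_real[of "real q"] q by simp
  thus ?thesis using q by (simp add: powr_def)
qed

lemma qpow_holomorphic: "qpow holomorphic_on X"
  unfolding qpow_exp by (intro holomorphic_intros)

lemma p_qpow_holomorphic: "(\<lambda>s. p (qpow s)) holomorphic_on X"
  using holomorphic_on_compose[OF qpow_holomorphic p_holomorphic, of X] by (simp add: o_def)

text \<open>An entire function that is not identically zero has isolated zeros.\<close>

lemma eventually_p_nonzero: "eventually (\<lambda>s. p (qpow s) \<noteq> 0) (at z)"
proof -
  \<comment> \<open>\<open>B\<close> exceeds the norm of every eigenvalue, so a point where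
    \<open>qpow\<close> has norm \<open>B\<close> witnesses that the function is not identically
    zero.\<close>
  define B where "B = 1 + (\<Sum>b\<in>spectrum C. norm b)"
  have B: "1 \<le> B" unfolding B_def by (simp add: sum_nonneg)
  define \<beta> :: complex where "\<beta> = of_real (log (real q) B)"
  have "norm (qpow \<beta>) = B" using q B by (simp add: norm_of_nat_powr \<beta>_def)
  moreover have "norm b < B" if "b \<in> spectrum C" for b
    using member_le_sum[OF that, of norm] finite_spectrum by (simp add: B_def)
  ultimately have "qpow \<beta> \<notin> spectrum C" by force
  hence "p (qpow \<beta>) \<noteq> 0" by (rule p_nonzero)
  from non_zero_neighbour_alt[OF p_qpow_holomorphic open_UNIV connected_UNIV UNIV_I UNIV_I this, of z]
  show ?thesis by simp
qed

lemma \<Psi>_carrier: "\<Psi> s \<in> carrier_mat d d"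
  unfolding \<Psi>_def by (rule smult_carrier_mat[OF mult_carrier_mat[OF N_carrier G_carrier]])

lemma one_minus_smult_C:
  assumes "X \<in> carrier_mat d d"
  shows "(qpow s \<cdot>\<^sub>m 1\<^sub>m d - C) * X = qpow s \<cdot>\<^sub>m ((1\<^sub>m d - qpow (- s) \<cdot>\<^sub>m C) * X)"
proof -
  have inv: "qpow s * qpow (- s) = 1" using q by (simp add: powr_minus)
  have "qpow s \<cdot>\<^sub>m 1\<^sub>m d - C = qpow s \<cdot>\<^sub>m (1\<^sub>m d - qpow (- s) \<cdot>\<^sub>m C)"
    using C_carrier inv by (intro eq_matI) (auto simp: right_diff_distrib mult.assoc[symmetric])
  thus ?thesis using C_carrier by (simp add: mult_smult_assoc_mat[OF _ assms, of _ d] minus_carrier_mat)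
qed

lemma smult_cancel:
  fixes X Y :: "complex mat"
  assumes "c \<noteq> 0" "X \<in> carrier_mat d d" "Y \<in> carrier_mat d d" "c \<cdot>\<^sub>m X = c \<cdot>\<^sub>m Y"
  shows "X = Y"
proof (rule eq_matI)
  fix i j assume ij: "i < dim_row Y" "j < dim_col Y"
  have "(c \<cdot>\<^sub>m X) $$ (i, j) = (c \<cdot>\<^sub>m Y) $$ (i, j)" using assms(4) by simp
  thus "X $$ (i, j) = Y $$ (i, j)" using ij assms(1-3) by simp
qed (use assms in auto)

lemma \<Psi>_functional_equation:
  assumes "p (qpow s) \<noteq> 0"
  shows "(1\<^sub>m d - qpow (- s) \<cdot>\<^sub>m C) * \<Psi> s = G s"
proof -
  define x where "x = qpow s"
  have x0: "x \<noteq> 0" using q by (simp add: x_def)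
  have X: "x \<cdot>\<^sub>m 1\<^sub>m d - C \<in> carrier_mat d d" using C_carrier by (simp add: minus_carrier_mat)
  have "(x \<cdot>\<^sub>m 1\<^sub>m d - C) * \<Psi> s = (x / p x) \<cdot>\<^sub>m ((x \<cdot>\<^sub>m 1\<^sub>m d - C) * (N x * G s))"
    unfolding \<Psi>_def x_def[symmetric]
    by (rule mult_smult_distrib[OF X mult_carrier_mat[OF N_carrier G_carrier]])
  also have "(x \<cdot>\<^sub>m 1\<^sub>m d - C) * (N x * G s) = (x \<cdot>\<^sub>m 1\<^sub>m d - C) * N x * G s"
    by (rule assoc_mult_mat[OF X N_carrier G_carrier, symmetric])
  also have "\<dots> = p x \<cdot>\<^sub>m G s"
    unfolding N_resolvent p_def[symmetric]
    using mult_smult_assoc_mat[OF one_carrier_mat G_carrier] left_mult_one_mat[OF G_carrier] by metis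
  also have "(x / p x) \<cdot>\<^sub>m (p x \<cdot>\<^sub>m G s) = x \<cdot>\<^sub>m G s"
    using assms by (intro eq_matI) (auto simp: x_def)
  finally have "x \<cdot>\<^sub>m ((1\<^sub>m d - qpow (- s) \<cdot>\<^sub>m C) * \<Psi> s) = x \<cdot>\<^sub>m G s"
    unfolding x_def one_minus_smult_C[OF \<Psi>_carrier] .
  thus ?thesis using C_carrier
    by (intro smult_cancel[OF x0 mult_carrier_mat[OF _ \<Psi>_carrier] G_carrier]) (auto simp: minus_carrier_mat)
qed

text \<open>The functional equation determines \<open>F s\<close> wherever x I - C is invertible.
  \<open>N_resolvent\<close> supplies a right inverse; for square matrices it is also the left
  inverse needed for cancelling.\<close>

lemma F_eq_\<Psi>:
  assumes "\<rho> < real q powr (Re s - 1)" "p (qpow s) \<noteq> 0"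
  shows "F s = \<Psi> s"
proof -
  define x where "x = qpow s"
  define X where "X = x \<cdot>\<^sub>m 1\<^sub>m d - C"
  have X: "X \<in> carrier_mat d d" using C_carrier by (simp add: X_def minus_carrier_mat)
  define Y where "Y = (1 / p x) \<cdot>\<^sub>m N x"
  have Y: "Y \<in> carrier_mat d d" using N_carrier by (simp add: Y_def)
  have px: "p x \<noteq> 0" using assms(2) by (simp add: x_def)
  have "X * Y = (1 / p x) \<cdot>\<^sub>m (X * N x)"
    unfolding Y_def by (rule mult_smult_distrib[OF X N_carrier])
  also have "X * N x = p x \<cdot>\<^sub>m 1\<^sub>m d" by (simp only: X_def N_resolvent p_def)
  also have "(1 / p x) \<cdot>\<^sub>m (p x \<cdot>\<^sub>m 1\<^sub>m d) = 1\<^sub>m d" using px by (intro eq_matI) auto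
  finally have YX: "Y * X = 1\<^sub>m d" by (rule mat_mult_left_right_inverse[OF X Y])
  have XF: "X * F s = x \<cdot>\<^sub>m G s"
    unfolding X_def x_def one_minus_smult_C[OF F_carrier] functional_equation[OF assms(1)] ..
  have "F s = Y * X * F s" unfolding YX left_mult_one_mat[OF F_carrier] ..
  also have "\<dots> = Y * (x \<cdot>\<^sub>m G s)"
    unfolding XF[symmetric] by (rule assoc_mult_mat[OF Y X F_carrier])
  also have "\<dots> = x \<cdot>\<^sub>m (Y * G s)" by (rule mult_smult_distrib[OF Y G_carrier])
  also have "Y * G s = (1 / p x) \<cdot>\<^sub>m (N x * G s)"
    unfolding Y_def by (rule mult_smult_assoc_mat[OF N_carrier G_carrier])
  also have "x \<cdot>\<^sub>m \<dots> = \<Psi> s"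
    unfolding \<Psi>_def x_def by (intro eq_matI) auto
  finally show ?thesis .
qed

lemma \<Phi>_eq_\<Psi>: "p (qpow s) \<noteq> 0 \<Longrightarrow> \<Phi> s = \<Psi> s"
  using F_eq_\<Psi> by (simp add: \<Phi>_def)

section \<open>Meromorphy and pole orders of the entries\<close>

definition num :: "nat \<Rightarrow> nat \<Rightarrow> complex \<Rightarrow> complex" where
  "num i j s = qpow s * (\<Sum>l<d. N (qpow s) $$ (i, l) * G s $$ (l, j))"

lemma \<Psi>_entry:
  assumes "i < d" "j < d"
  shows "\<Psi> s $$ (i, j) = num i j s / p (qpow s)"
proof -
  have "\<Psi> s $$ (i, j) = qpow s / p (qpow s) * (N (qpow s) * G s) $$ (i, j)"
    using assms carrier_matD[OF N_carrier] carrier_matD[OF G_carrier] by (simp add: \<Psi>_def)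
  thus ?thesis unfolding num_def mat_mult_entry[OF N_carrier G_carrier assms] by simp
qed

lemma open_H0: "open {s. \<rho> < real q powr Re s}"
  using q open_halfplane[of q \<rho> 0] by simp

lemma num_holomorphic:
  assumes "i < d" "j < d"
  shows "num i j holomorphic_on {s. \<rho> < real q powr Re s}"
proof -
  have "(\<lambda>s. N (qpow s) $$ (i, l)) holomorphic_on {s. \<rho> < real q powr Re s}" if "l < d" for l
  proof -
    have "(\<lambda>x. N x $$ (i, l)) holomorphic_on qpow ` {s. \<rho> < real q powr Re s}"
      using N_holomorphic that assms by (auto simp: holomorphic_mat_def intro: holomorphic_on_subset)
    from holomorphic_on_compose[OF qpow_holomorphic this] show ?thesis by (simp add: o_def)
  qed
  thus ?thesis unfolding num_def using assms
    by (intro holomorphic_intros qpow_holomorphic G_holomorphic) auto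
qed

text \<open>Meromorphy and \<open>zorder\<close> depend only on punctured neighbourhoods, so in the
  half-plane both can be read off this quotient of holomorphic functions, whatever the values at
  zeros of the denominator.\<close>

lemma eventually_\<Phi>_entry:
  assumes "i < d" "j < d"
  shows "eventually (\<lambda>s. \<Phi> s $$ (i, j) = num i j s / p (qpow s)) (at z)"
  using eventually_p_nonzero by eventually_elim (simp add: \<Phi>_eq_\<Psi> \<Psi>_entry[OF assms])

lemma \<Phi>_meromorphic:
  assumes "i < d" "j < d"
  shows "(\<lambda>s. \<Phi> s $$ (i, j)) meromorphic_on {s. \<rho> < real q powr Re s}"
proof -
  have "(\<lambda>s. num i j s / p (qpow s)) meromorphic_on {s. \<rho> < real q powr Re s}"
    using num_holomorphic[OF assms] p_qpow_holomorphic open_H0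
    by (intro meromorphic_on_divide analytic_on_imp_meromorphic_on) (simp_all add: analytic_on_open)
  thus ?thesis
    by (subst meromorphic_on_cong[OF eventually_\<Phi>_entry[OF assms] refl])
qed

lemma open_regular: "open {s. \<rho> < real q powr Re s \<and> qpow s \<notin> spectrum C}"
proof -
  have "open (- spectrum C)" using finite_spectrum by (intro open_Compl finite_imp_closed)
  moreover have "continuous_on UNIV qpow"
    by (intro holomorphic_on_imp_continuous_on qpow_holomorphic)
  ultimately have "open (qpow -` (- spectrum C))" by (intro open_vimage)
  from open_Int[OF open_H0 this] show ?thesis by (simp add: Int_def vimage_def)
qed

lemma \<Phi>_analytic:
  assumes "i < d" "j < d"
  shows "(\<lambda>s. \<Phi> s $$ (i, j)) analytic_on {s. \<rho> < real q powr Re s \<and> qpow s \<notin> spectrum C}"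
  unfolding analytic_on_open[OF open_regular]
proof (rule holomorphic_transform)
  show "(\<lambda>s. num i j s / p (qpow s)) holomorphic_on {s. \<rho> < real q powr Re s \<and> qpow s \<notin> spectrum C}"
    using p_nonzero
    by (intro holomorphic_intros p_qpow_holomorphic holomorphic_on_subset[OF num_holomorphic[OF assms]]) auto
qed (simp add: p_nonzero \<Phi>_eq_\<Psi> \<Psi>_entry[OF assms])

text \<open>Only the factor of \<open>lam\<close> vanishes at \<open>z\<close>, and q^s - lam has a
  simple zero there since its derivative q^z ln q is nonzero. The order is thus the exponent of that
  factor.\<close>

lemma zorder_p_qpow:
  assumes "qpow z = lam" "lam \<in> spectrum C"
  shows "zorder (\<lambda>s. p (qpow s)) z = int (jordan_index C lam)"
proof -
  define h where "h s = (\<Prod>b\<in>spectrum C - {lam}. (qpow s - b) ^ jordan_index C b)" for s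
  have p: "p (qpow s) = (qpow s - lam) ^ jordan_index C lam * h s" for s
    unfolding p_def polyval_def h_def by (rule prod.remove[OF finite_spectrum assms(2)])
  have an: "f analytic_on {z}" if "f holomorphic_on UNIV" for f :: "complex \<Rightarrow> complex"
    using that analytic_at by blast
  have lin: "(\<lambda>s. qpow s - lam) holomorphic_on UNIV" by (intro holomorphic_intros qpow_holomorphic)
  have h: "h holomorphic_on UNIV" unfolding h_def by (intro holomorphic_intros qpow_holomorphic)
  have hz: "h z \<noteq> 0" using assms finite_spectrum by (auto simp: h_def)
  have lnq: "ln (real q) \<noteq> 0" using q by simp
  have der: "((\<lambda>s. qpow s - lam) has_field_derivative (qpow z * of_real (ln (real q)))) (at z)"
    unfolding qpow_exp by (auto intro!: derivative_eq_intros)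
  have zlin: "zorder (\<lambda>s. qpow s - lam) z = 1"
  proof (rule zorder_zero_eqI'[OF an[OF lin]])
    show "(deriv ^^ i) (\<lambda>s. qpow s - lam) z = 0" if "i < nat 1" for i
      using that assms(1) by simp
    have "deriv (\<lambda>s. qpow s - lam) z = qpow z * of_real (ln (real q))" by (rule DERIV_imp_deriv[OF der])
    thus "(deriv ^^ nat 1) (\<lambda>s. qpow s - lam) z \<noteq> 0" using lnq q by simp
  qed simp
  have evh: "eventually (\<lambda>s. h s \<noteq> 0) (at z)"
    using non_zero_neighbour_alt[OF h open_UNIV connected_UNIV UNIV_I UNIV_I hz, of z] by simp
  have evl: "eventually (\<lambda>s. qpow s - lam \<noteq> 0) (at z)"
  proof -
    \<comment> \<open>As \<open>lam = qpow z\<close> is nonzero, \<open>q * lam\<close> differs from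
      it, so this function is not identically zero.\<close>
    have "qpow (z + 1) - lam \<noteq> 0"
      using assms(1) q by (auto simp: powr_add)
    from non_zero_neighbour_alt[OF lin open_UNIV connected_UNIV UNIV_I UNIV_I this, of z]
    show ?thesis by simp
  qed
  have freq: "frequently P (at z)" if "eventually P (at z)" for P
    using that eventually_frequently at_neq_bot by blast
  have ml: "(\<lambda>s. qpow s - lam) meromorphic_on {z}" and mh: "h meromorphic_on {z}"
    by (intro analytic_on_imp_meromorphic_on an lin h)+
  have "zorder (\<lambda>s. p (qpow s)) z = zorder (\<lambda>s. (qpow s - lam) ^ jordan_index C lam) z + zorder h z"
    unfolding p
  proof (rule zorder_mult)
    show "(\<lambda>s. (qpow s - lam) ^ jordan_index C lam) meromorphic_on {z}"
      by (intro meromorphic_intros ml)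
    show "\<exists>\<^sub>F s in at z. (qpow s - lam) ^ jordan_index C lam \<noteq> 0"
      by (rule freq, use evl in eventually_elim) auto
  qed (use mh freq[OF evh] in auto)
  also have "zorder h z = 0" by (rule zorder_eq_0I[OF an[OF h] hz])
  also have "zorder (\<lambda>s. (qpow s - lam) ^ jordan_index C lam) z = int (jordan_index C lam)"
    using zorder_power[OF ml freq[OF evl]] zlin by simp
  finally show ?thesis by simp
qed

text \<open>The numerator is holomorphic and so has nonnegative order; the quotient cannot have a
  pole of higher order than the zero of its denominator.\<close>

lemma pole_order_le:
  assumes ij: "i < d" "j < d" and z: "\<rho> < real q powr Re z" "qpow z = lam" "lam \<in> spectrum C"
    and pole: "is_pole (\<lambda>s. \<Phi> s $$ (i, j)) z"
  shows "- zorder (\<lambda>s. \<Phi> s $$ (i, j)) z \<le> int (jordan_index C lam)"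
proof -
  note ev = eventually_\<Phi>_entry[OF ij, of z]
  have freq: "frequently P (at z)" if "eventually P (at z)" for P
    using that eventually_frequently at_neq_bot by blast
  have an: "num i j analytic_on {z}"
    using num_holomorphic[OF ij] open_H0 z(1) analytic_at by blast
  \<comment> \<open>The pole rules out that the numerator vanishes identically near
    \<open>z\<close>, in which case its order would carry no information.\<close>
  have "eventually (\<lambda>s. num i j s \<noteq> 0) (at z)"
    using ev non_zero_neighbour_pole[OF pole] by eventually_elim auto
  note num_nz = freq[OF this]
  have "zorder (\<lambda>s. \<Phi> s $$ (i, j)) z = zorder (\<lambda>s. num i j s / p (qpow s)) z"
    by (rule zorder_cong[OF ev refl])
  also have "\<dots> = zorder (num i j) z - zorder (\<lambda>s. p (qpow s)) z"
  proof (rule zorder_divide[OF _ num_nz _ freq[OF eventually_p_nonzero]])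
    show "(\<lambda>s. p (qpow s)) meromorphic_on {z}"
      using p_qpow_holomorphic[of UNIV] analytic_at by (intro analytic_on_imp_meromorphic_on) blast
  qed (rule analytic_on_imp_meromorphic_on[OF an])
  finally show ?thesis using zorder_ge_0[OF an num_nz] zorder_p_qpow[OF z(2,3)] by simp
qed

text \<open>For positive \<rho>, a bounded resolvent meets \<open>G_growth\<close> on the strip from
  \<open>a\<close> to \<open>a + 1\<close>, and to the right of the strip the Dirichlet series
  itself is bounded.\<close>

lemma \<Phi>_growth:
  assumes \<delta>: "0 < \<delta>"
  shows "\<exists>T M. \<forall>s. \<rho> \<le> real q powr (Re s - \<delta>) \<and> (\<forall>lam\<in>spectrum C. \<delta> \<le> cmod (qpow s - lam)) \<and>
    T \<le> \<bar>Im s\<bar> \<longrightarrow> (\<forall>i<d. \<forall>j<d. cmod (\<Phi> s $$ (i, j)) \<le> M * \<bar>Im s\<bar> powr mu q \<rho> \<delta> (Re s))"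
proof (cases "\<rho> = 0")
  case True
  \<comment> \<open>For \<open>\<rho> = 0\<close> the condition on \<open>Re s\<close> holds
    everywhere. The spectrum is nonempty and contains only 0, so the distance condition reads
    \<open>\<delta> \<le> real q powr Re s\<close> and bounds \<open>Re s\<close> from
    below.\<close>
  obtain lam where "lam \<in> spectrum C" using spectrum_non_empty[OF C_carrier] d by auto
  moreover from spectrum_le_jsr[OF this] have "lam = 0" by (simp add: True)
  ultimately have zero: "0 \<in> spectrum C" by simp
  define \<sigma> where "\<sigma> = log (real q) \<delta>"
  have pos: "0 < real q powr t" for t using q by simp
  show ?thesis
  proof (rule exI[of _ 1], rule exI[of _ "Fbound \<sigma>"], intro allI impI, elim conjE)
    fix s i j assume s: "\<forall>lam\<in>spectrum C. \<delta> \<le> cmod (qpow s - lam)" "1 \<le> \<bar>Im s\<bar>" and ij: "i < d" "j < d"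
    have "\<delta> \<le> real q powr Re s" using bspec[OF s(1) zero] by (simp add: norm_of_nat_powr)
    hence "\<sigma> \<le> Re s" using q \<delta> by (simp add: \<sigma>_def log_le_iff)
    hence "cmod (F s $$ (i, j)) \<le> Fbound \<sigma>"
      unfolding Fbound_def using ij pos by (intro norm_F_le) (auto simp: True)
    moreover have "\<Phi> s = F s" using pos by (simp add: \<Phi>_def True)
    ultimately show "cmod (\<Phi> s $$ (i, j)) \<le> Fbound \<sigma> * \<bar>Im s\<bar> powr mu q \<rho> \<delta> (Re s)"
      using s(2) by (simp add: mu_def True)
  qed
next
  case False
  hence \<rho>: "0 < \<rho>" using jsr_nonneg by linarith
  define a where "a = log (real q) \<rho> + \<delta>"
  have "log (real q) \<rho> < a" using \<delta> by (simp add: a_def)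
  hence a: "\<rho> < real q powr a" using q \<rho> by (simp add: log_less_iff)
  obtain M where M: "0 \<le> M" "\<And>s i j. i < d \<Longrightarrow> j < d \<Longrightarrow> a \<le> Re s \<Longrightarrow> Re s \<le> a + 1 \<Longrightarrow> 1 \<le> \<bar>Im s\<bar> \<Longrightarrow>
      norm (G s $$ (i, j)) \<le> M * \<bar>Im s\<bar> powr (1 - (Re s - a))"
    using G_growth[OF a] by blast
  \<comment> \<open>A compact set, free of zeros of \<open>p\<close>, containing
    \<open>qpow s\<close> for all admissible \<open>s\<close> in the strip; a bound on it is uniform
    in \<open>Im s\<close>.\<close>
  define X where "X = {x. real q powr a \<le> norm x} \<inter> cball 0 (real q powr (a + 1)) \<inter>
    (\<Inter>lam\<in>spectrum C. {x. \<delta> \<le> cmod (x - lam)})"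
  have "compact X"
    unfolding X_def
    by (intro compact_Int_closed closed_Int_compact closed_INT ballI compact_cball
        closed_Collect_le continuous_intros)
  have Xp: "p x \<noteq> 0" if "x \<in> X" for x
    using that \<delta> by (intro p_nonzero) (auto simp: X_def)
  define h where "h x = (\<Sum>i<d. \<Sum>l<d. norm (x / p x * N x $$ (i, l)))" for x
  have "continuous_on X h"
  proof -
    have "continuous_on X p" by (intro holomorphic_on_imp_continuous_on p_holomorphic)
    moreover have "continuous_on X (\<lambda>x. N x $$ (i, l))" if "i < d" "l < d" for i l
      using N_holomorphic that unfolding holomorphic_mat_def
      by (meson continuous_on_subset holomorphic_on_imp_continuous_on subset_UNIV)
    ultimately show ?thesis unfolding h_def using Xp by (intro continuous_intros) auto
  qed
  hence "bounded (h ` X)"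
    using \<open>compact X\<close> by (intro compact_imp_bounded compact_continuous_image)
  then obtain K where K: "\<And>x. x \<in> X \<Longrightarrow> norm (h x) \<le> K" unfolding bounded_iff by blast
  \<comment> \<open>\<open>X\<close> may be empty and \<open>K\<close> then negative, hence the
    absolute value.\<close>
  have K': "norm (x / p x * N x $$ (i, l)) \<le> \<bar>K\<bar>" if "x \<in> X" "i < d" "l < d" for x i l
  proof -
    have "norm (x / p x * N x $$ (i, l)) \<le> (\<Sum>l<d. norm (x / p x * N x $$ (i, l)))"
      using that by (intro member_le_sum) auto
    also have "\<dots> \<le> h x"
      unfolding h_def using that
      by (intro member_le_sum[where f = "\<lambda>i. \<Sum>l<d. norm (x / p x * N x $$ (i, l))"] sum_nonneg) (auto intro: sum_nonneg)
    also have "\<dots> \<le> \<bar>K\<bar>" using K[OF that(1)] by simp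
    finally show ?thesis .
  qed
  have F0: "0 \<le> Fbound (a + 1)" using a by (intro Fbound_nonneg) simp
  define M' where "M' = real d * (\<bar>K\<bar> * M) + Fbound (a + 1)"
  show ?thesis
  proof (rule exI[of _ 1], rule exI[of _ M'], intro allI impI, elim conjE)
    fix s i j
    assume s: "\<rho> \<le> real q powr (Re s - \<delta>)" "\<forall>lam\<in>spectrum C. \<delta> \<le> cmod (qpow s - lam)" "1 \<le> \<bar>Im s\<bar>"
      and ij: "i < d" "j < d"
    have "log (real q) \<rho> \<le> Re s - \<delta>" using s(1) q \<rho> by (simp add: log_le_iff)
    hence as: "a \<le> Re s" by (simp add: a_def)
    define Y where "Y = \<bar>Im s\<bar> powr mu q \<rho> \<delta> (Re s)"
    have mu: "mu q \<rho> \<delta> (Re s) = max (1 - (Re s - a)) 0" using False by (simp add: mu_def a_def)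
    have Y: "1 \<le> Y" unfolding Y_def using s(3) by (intro ge_one_powr_ge_zero) (simp_all add: mu)
    show "cmod (\<Phi> s $$ (i, j)) \<le> M' * \<bar>Im s\<bar> powr mu q \<rho> \<delta> (Re s)"
    proof (cases "Re s \<le> a + 1")
      case True
      have "0 \<le> 1 - (Re s - a)" using True by simp
      hence Yeq: "Y = \<bar>Im s\<bar> powr (1 - (Re s - a))" by (simp only: Y_def mu max_absorb1)
      have "real q powr Re s \<le> real q powr (a + 1)" "real q powr a \<le> real q powr Re s"
        using True as q by (auto intro!: powr_mono)
      hence X: "qpow s \<in> X" using s(2) by (auto simp: X_def norm_of_nat_powr)
      have "\<Phi> s $$ (i, j) = (\<Sum>l<d. (qpow s / p (qpow s) * N (qpow s) $$ (i, l)) * G s $$ (l, j))"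
        unfolding \<Phi>_eq_\<Psi>[OF Xp[OF X]] \<Psi>_entry[OF ij] num_def
        by (simp add: sum_distrib_left sum_divide_distrib mult_ac)
      also have "norm \<dots> \<le> (\<Sum>l<d. \<bar>K\<bar> * (M * Y))"
      proof (rule sum_norm_le)
        fix l assume "l \<in> {..<d}"
        thus "norm ((qpow s / p (qpow s) * N (qpow s) $$ (i, l)) * G s $$ (l, j)) \<le> \<bar>K\<bar> * (M * Y)"
          unfolding norm_mult[of _ "G s $$ _"] Yeq using True as s(3) ij
          by (intro mult_mono K'[OF X] M(2)) auto
      qed
      also have "\<dots> = real d * (\<bar>K\<bar> * M) * Y" by simp
      also have "\<dots> \<le> M' * Y" unfolding M'_def using F0 Y by (intro mult_right_mono) auto
      finally show ?thesis by (simp only: Y_def)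
    next
      case False
      hence "\<rho> < real q powr (Re s - 1)" by (intro halfplane_mono[OF a]) simp
      hence "\<Phi> s = F s" by (simp add: \<Phi>_def)
      have "cmod (\<Phi> s $$ (i, j)) \<le> Fbound (a + 1)"
        unfolding Fbound_def \<open>\<Phi> s = F s\<close> using ij False a by (intro norm_F_le) auto
      also have "\<dots> \<le> M'" unfolding M'_def using M(1) by simp
      also have "\<dots> \<le> M' * Y" using Y \<open>Fbound (a + 1) \<le> M'\<close> F0 mult_left_mono[of 1 Y M'] by simp
      finally show ?thesis by (simp only: Y_def)
    qed
  qed
qed

section \<open>The points where q^s is an eigenvalue\<close>

definition pole_at :: "complex \<Rightarrow> int \<Rightarrow> complex" where
  "pole_at lam l = Ln lam / of_real (ln (real q)) + 2 * of_real pi * \<i> * of_int l / of_real (ln (real q))"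

lemma qpow_pole_at:
  assumes "lam \<noteq> 0"
  shows "qpow (pole_at lam l) = lam"
proof -
  have "ln (real q) \<noteq> 0" using q by simp
  hence "pole_at lam l * of_real (ln (real q)) = Ln lam + (of_int (2 * l) * pi) * \<i>"
    by (simp add: pole_at_def field_simps)
  hence "qpow (pole_at lam l) = exp (Ln lam)"
    unfolding qpow_exp exp_eq by blast
  thus ?thesis using assms by simp
qed

lemma spectrum_imp_pole_at:
  assumes "qpow s \<in> spectrum C"
  shows "\<exists>l. s = pole_at (qpow s) l"
proof -
  have lnq: "ln (real q) \<noteq> 0" using q by simp
  have "exp (s * of_real (ln (real q))) = exp (Ln (qpow s))"
    unfolding qpow_exp by simp
  then obtain l :: int where "s * of_real (ln (real q)) = Ln (qpow s) + (of_int (2 * l) * pi) * \<i>"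
    unfolding exp_eq by blast
  hence "s = pole_at (qpow s) l" using lnq by (simp add: pole_at_def field_simps)
  thus ?thesis by blast
qed

text \<open>The solutions of q^s = lam form one arithmetic progression, and
  \<open>norm (qpow s) = real q powr Re s\<close> turns the half-plane condition into
  \<open>\<rho> < cmod lam\<close>.\<close>

lemma regular_points:
  "{s. \<rho> < real q powr Re s} - {pole_at lam l | lam l. lam \<in> spectrum C \<and> \<rho> < cmod lam} =
   {s. \<rho> < real q powr Re s \<and> qpow s \<notin> spectrum C}" (is "?L = ?R")
proof (intro equalityI subsetI)
  fix s assume s: "s \<in> ?L"
  have "qpow s \<notin> spectrum C"
  proof
    assume sp: "qpow s \<in> spectrum C"
    obtain l where "s = pole_at (qpow s) l" using spectrum_imp_pole_at[OF sp] by blast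
    moreover have "\<rho> < cmod (qpow s)" using s by (simp add: norm_of_nat_powr)
    ultimately show False using s sp by blast
  qed
  thus "s \<in> ?R" using s by simp
next
  fix s assume s: "s \<in> ?R"
  \<comment> \<open>Since \<rho> is nonnegative, \<open>\<rho> < cmod lam\<close> excludes 0, which
    has no logarithm.\<close>
  have "qpow (pole_at lam l) = lam" if "\<rho> < cmod lam" for lam l
    using that jsr_nonneg by (intro qpow_pole_at) auto
  thus "s \<in> ?L" using s by auto
qed

lemma pole_at_in_H0:
  assumes "\<rho> < cmod lam"
  shows "\<rho> < real q powr Re (pole_at lam l)"
proof -
  have "lam \<noteq> 0" using assms jsr_nonneg by auto
  from qpow_pole_at[OF this, of l] show ?thesis using assms norm_of_nat_powr[of q "pole_at lam l"] by simp
qed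

end

theorem theoremA3:
  fixes q d n0 :: nat and A :: "nat \<Rightarrow> complex mat"
  assumes q: "q \<ge> 2" and d: "d \<ge> 1" and A: "\<forall>r<q. A r \<in> carrier_mat d d" and n0: "n0 \<ge> 1"
  shows
   "let rho = jsr q d A; C = sumA q d A; F = dirF q d A n0; G = dirG q d A n0;
        H1 = {s. rho < real q powr (Re s - 1)};
        H0 = {s. rho < real q powr Re s};
        P = {Ln lam / of_real (ln (real q)) + 2 * of_real pi * \<i> * of_int l / of_real (ln (real q)) |
               lam l. lam \<in> spectrum C \<and> rho < cmod lam}
    in
    (\<forall>K. compact K \<and> K \<subseteq> H1 \<longrightarrow> (\<forall>i<d. \<forall>j<d.
        uniform_limit K (\<lambda>N s. \<Sum>k<N. norm (dterm q d A n0 i j k s))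
                        (\<lambda>s. \<Sum>k. norm (dterm q d A n0 i j k s)) sequentially \<and>
        uniform_limit K (\<lambda>N s. \<Sum>k<N. dterm q d A n0 i j k s) (\<lambda>s. F s $$ (i, j)) sequentially)) \<and>
    (\<forall>i<d. \<forall>j<d. (\<lambda>s. F s $$ (i, j)) analytic_on H1) \<and>
    (\<forall>s\<in>H1. (1\<^sub>m d - ((of_nat q :: complex) powr (- s)) \<cdot>\<^sub>m C) * F s = G s) \<and>
    (\<forall>K. compact K \<and> K \<subseteq> H0 \<longrightarrow> (\<forall>r<q. \<forall>i<d. \<forall>j<d.
        uniform_limit K (\<lambda>N s. \<Sum>k<N. norm (bterm q d A n0 r i j k s))
                        (\<lambda>s. \<Sum>k. norm (bterm q d A n0 r i j k s)) sequentially \<and>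
        uniform_limit K (\<lambda>N s. \<Sum>k<N. bterm q d A n0 r i j k s)
                        (\<lambda>s. binser q d A n0 r s $$ (i, j)) sequentially)) \<and>
    (\<exists>\<Phi> :: complex \<Rightarrow> complex mat.
        (\<forall>s\<in>H1. \<Phi> s = F s) \<and>
        (\<forall>s\<in>H0 - P. (1\<^sub>m d - ((of_nat q :: complex) powr (- s)) \<cdot>\<^sub>m C) * \<Phi> s = G s) \<and>
        (\<forall>i<d. \<forall>j<d.
            (\<lambda>s. \<Phi> s $$ (i, j)) meromorphic_on H0 \<and>
            (\<lambda>s. \<Phi> s $$ (i, j)) analytic_on (H0 - P) \<and>
            (\<forall>lam\<in>spectrum C. rho < cmod lam \<longrightarrow> (\<forall>l::int.
               let z = Ln lam / of_real (ln (real q)) + 2 * of_real pi * \<i> * of_int l / of_real (ln (real q))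
               in is_pole (\<lambda>s. \<Phi> s $$ (i, j)) z \<longrightarrow>
                  - zorder (\<lambda>s. \<Phi> s $$ (i, j)) z \<le> int (jordan_index C lam)))) \<and>
        (\<forall>\<delta>>0. \<exists>T M. \<forall>s.
            rho \<le> real q powr (Re s - \<delta>) \<and>
            (\<forall>lam\<in>spectrum C. \<delta> \<le> cmod ((of_nat q :: complex) powr s - lam)) \<and>
            T \<le> \<bar>Im s\<bar> \<longrightarrow>
            (\<forall>i<d. \<forall>j<d. cmod (\<Phi> s $$ (i, j)) \<le> M * \<bar>Im s\<bar> powr mu q rho \<delta> (Re s))))"
proof -
  interpret S: regular_matrix_sequence q d n0 A
    using assms by unfold_locales auto
  obtain N where N: "holomorphic_mat d N"
    "\<And>x. (x \<cdot>\<^sub>m 1\<^sub>m d - sumA q d A) * N x =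
      polyval (spectrum (sumA q d A)) (jordan_index (sumA q d A)) x \<cdot>\<^sub>m 1\<^sub>m d"
    using resolvent_numerator[OF S.C_carrier] by blast
  interpret R: regular_matrix_resolvent q d n0 A N
    using N by unfold_locales
  have H1: "(\<lambda>s. dirF q d A n0 s $$ (i, j)) analytic_on {s. jsr q d A < real q powr (Re s - 1)}"
    if "i < d" "j < d" for i j
    using S.F_holomorphic[OF that] q by (subst analytic_on_open) (auto intro: open_halfplane)
  have eq: "(1\<^sub>m d - (of_nat q powr (- s)) \<cdot>\<^sub>m sumA q d A) * R.\<Phi> s = dirG q d A n0 s"
    if "of_nat q powr s \<notin> spectrum (sumA q d A)" for s
    unfolding R.\<Phi>_eq_\<Psi>[OF R.p_nonzero[OF that]]
    by (rule R.\<Psi>_functional_equation[OF R.p_nonzero[OF that]])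
  have pole: "- zorder (\<lambda>s. R.\<Phi> s $$ (i, j)) (R.pole_at lam l) \<le> int (jordan_index (sumA q d A) lam)"
    if "i < d" "j < d" "lam \<in> spectrum (sumA q d A)" "jsr q d A < cmod lam"
      "is_pole (\<lambda>s. R.\<Phi> s $$ (i, j)) (R.pole_at lam l)" for i j lam l
  proof -
    have "lam \<noteq> 0" using that(4) S.jsr_nonneg by auto
    thus ?thesis using R.pole_order_le[OF that(1,2) R.pole_at_in_H0[OF that(4)] R.qpow_pole_at that(3,5)] by simp
  qed
  \<comment> \<open>Folding the explicit formula into \<open>pole_at\<close> brings the half-plane
    without the exceptional points into the form that \<open>regular_points\<close>
    rewrites.\<close>
  show ?thesis
    unfolding Let_def R.pole_at_def[symmetric] R.regular_points
    using S.dirichlet_series_uniform_limit H1 S.functional_equation S.binomial_series_uniform_limit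
      R.\<Phi>_meromorphic R.\<Phi>_analytic R.\<Phi>_growth eq pole
    by (intro conjI exI[of _ R.\<Phi>]) (simp_all add: R.\<Phi>_def)
qed

end
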